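(* Let $m\ge2$. The $m$-dimensional Brun algorithm $T_{\rm B}:[0,1]^m\to[0,1]^m$ defined in the context satisfies the Markov assumption and the Non-arithmeticity assumption.
   Context: Brun algorithm: for $x=(x_1,\dots,x_m)\in[0,1]^m$, with $x_i=\max_k x_k$, $$T_{\rm B}(x_1,\dots,x_m)=\left(\frac{x_{i+1}}{x_i},\dots,\frac{x_m}{x_i},\left\{\frac1{x_i}\right\},\frac{x_1}{x_i},\dots,\frac{x_{i-1}}{x_i}\right)\ \text{if }x_i\ne0,\qquad T_{\rm B}(x)=(0,\dots,0)\ \text{otherwise},$$ where $\{\cdot\}$ is the fractional part. General setting (applied here with $I=[0,1]^m$, $T=T_{\rm B}$ and $\{I_j\}_{j\in J}$ the partition into the domains of the branches of $T_{\rm B}$): $I\subset\mathbb{R}^m$ is compact connected, $T:I\to I$, and $\{I_j\}_{j\in J}$ is a countable partition (modulo a null set) of $I$ into pairwise disjoint open sets with $I=\bigcup_j\overline{I_j}$, each $T|_{I_j}:I_j\to T(I_j)$ bijective and extending to a $C^{1+\mathrm{Lip}}$ map on $\overline{I_j}$. Put $h_j=(T|_{I_j})^{-1}$ and $\mathcal{H}=\{h_j:j\in J\}$. Inductively $I_{j_1,\dots,j_n}=\{x\in I_{j_1}:T(x)\in I_{j_2,\dots,j_n}\}$; then $h=h_{j_1}\circ\cdots\circ h_{j_n}$ induces a bijection $T^n(I_{j_1,\dots,j_n})\to I_{j_1,\dots,j_n}$ and is called an admissible inverse branch of depth $n$; $\mathcal{H}^n$ is the set of these, $\mathcal{H}^\ast=\bigcup_{n\ge1}\mathcal{H}^n$,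 $\mathrm{Dom}(h)$ is the domain of $h$ and $|J_h(x)|=|\det Dh(x)|$. Markov assumption: $T$ is topologically transitive (some point has a dense orbit) and: (1) there is $0<\rho<1$ with $|h(x)-h(y)|\le\rho^n|x-y|$ for all $n\ge1$, $h\in\mathcal{H}^n$, $x,y\in\mathrm{Dom}(h)$; (2) there is $M>0$ with $\left|\frac{J_h(x)}{J_h(y)}-1\right|\le M|x-y|$ for all $n\ge1$, $h\in\mathcal{H}^n$, $x,y\in\mathrm{Dom}(h)$; (3) there is a finite partition (modulo a null set) $\mathcal{P}=\{P_a\}_{a\in A}$ of $I$ into pairwise disjoint open subsets with $I=\bigcup_a\overline{P_a}$ such that each $T(I_j)$ is a union of closures of elements of $\mathcal{P}$; if $I_j\cap P_a\ne\emptyset$ then $I_j\subset P_a$; and for $j\in J$, $a\in A$ either there is a unique $b\in A$ with $h_j(P_a)\subset P_b\cap I_j$, or $h_j(P_a)\cap I=\emptyset$. Non-arithmeticity assumption: there is no $c\in\mathbb{R}$ with $\{-\log|J_h(x)|:x\in I,\ h\in\mathcal{H}^\ast,\ h(x)=x\}\subset c\mathbb{Z}$.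
   Formalization: False as literally stated for T_B; proved with |h(x)-h(y)| ≤ Cρ^n|x-y| for some C>0 instead of ρ^n|x-y|, with I = closure of the union of the I_j (the origin lies in no closure of an I_j), and with closure of T(I_j), which is open, as the union of closures of elements of P. *)

theory Defs
  imports "HOL-Analysis.Analysis"
begin

section \<open>Piecewise invertible maps and their inverse branches\<close>

text \<open>
  A system is given by a set \<open>I\<close>, a map \<open>T\<close>, an index set \<open>J\<close> and a family \<open>D\<close> of branch domains.
\<close>

definition open_partition :: "(real^'n) set \<Rightarrow> 'a set \<Rightarrow> ('a \<Rightarrow> (real^'n) set) \<Rightarrow> bool" where
  "open_partition I A P \<longleftrightarrow>
     (\<forall>a\<in>A. open (P a) \<and> P a \<noteq> {} \<and> P a \<subseteq> I) \<and>
     disjoint_family_on P A \<and>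
     negligible (I - (\<Union>a\<in>A. P a))"

definition C1_Lip_extendable :: "(real^'n \<Rightarrow> real^'n) \<Rightarrow> (real^'n) set \<Rightarrow> bool" where
  "C1_Lip_extendable T S \<longleftrightarrow>
     (\<exists>(g :: real^'n \<Rightarrow> real^'n) (G :: real^'n \<Rightarrow> (real^'n) \<Rightarrow>\<^sub>L (real^'n)) L.
        (\<forall>x\<in>S. g x = T x) \<and>
        (\<forall>x\<in>closure S. (g has_derivative blinfun_apply (G x)) (at x within closure S)) \<and>
        L-lipschitz_on (closure S) G)"

text \<open>
  The covering condition is \<open>I = closure (\<Union>j. D j)\<close>, not \<open>I = (\<Union>j. closure (D j))\<close>. The two
  agree for finite \<open>J\<close>; for infinite \<open>J\<close> the latter fails already for the Gauss map and for the
  Brun algorithm, where the origin is only an accumulation point of branch domains.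
\<close>

definition branch_system ::
  "(real^'n) set \<Rightarrow> (real^'n \<Rightarrow> real^'n) \<Rightarrow> 'j set \<Rightarrow> ('j \<Rightarrow> (real^'n) set) \<Rightarrow> bool" where
  "branch_system I T J D \<longleftrightarrow>
     compact I \<and> connected I \<and> T ` I \<subseteq> I \<and>
     countable J \<and> open_partition I J D \<and> I = closure (\<Union>j\<in>J. D j) \<and>
     (\<forall>j\<in>J. inj_on T (D j) \<and> C1_Lip_extendable T (D j))"

text \<open>
  An element of \<open>\<H>\<^sup>n\<close> is represented by its word \<open>[j\<^sub>1, \<dots>, j\<^sub>n]\<close>. Since \<open>T\<close> maps \<open>I\<close> to itself,
  starting the recursion at the empty word gives \<open>cylinder I T D [j] = D j\<close>.
\<close>

primrec cylinder ::
  "(real^'n) set \<Rightarrow> (real^'n \<Rightarrow> real^'n) \<Rightarrow> ('j \<Rightarrow> (real^'n) set) \<Rightarrow> 'j list \<Rightarrow> (real^'n) set" where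
  "cylinder I T D [] = I"
| "cylinder I T D (j # js) = {x \<in> D j. T x \<in> cylinder I T D js}"

definition admissible_words ::
  "(real^'n) set \<Rightarrow> (real^'n \<Rightarrow> real^'n) \<Rightarrow> 'j set \<Rightarrow> ('j \<Rightarrow> (real^'n) set) \<Rightarrow> 'j list set" where
  "admissible_words I T J D = {js. js \<noteq> [] \<and> set js \<subseteq> J \<and> cylinder I T D js \<noteq> {}}"

primrec inv_branch ::
  "(real^'n \<Rightarrow> real^'n) \<Rightarrow> ('j \<Rightarrow> (real^'n) set) \<Rightarrow> 'j list \<Rightarrow> real^'n \<Rightarrow> real^'n" where
  "inv_branch T D [] = id"
| "inv_branch T D (j # js) = inv_into (D j) T \<circ> inv_branch T D js"

text \<open>\<open>inv_branch T D js\<close> is a total function, meaningful only on the following set.\<close>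

definition branch_dom ::
  "(real^'n) set \<Rightarrow> (real^'n \<Rightarrow> real^'n) \<Rightarrow> ('j \<Rightarrow> (real^'n) set) \<Rightarrow> 'j list \<Rightarrow> (real^'n) set" where
  "branch_dom I T D js = (T ^^ length js) ` cylinder I T D js"

definition jacobian :: "(real^'n \<Rightarrow> real^'n) \<Rightarrow> real^'n \<Rightarrow> real" where
  "jacobian h x = det (matrix (frechet_derivative h (at x)))"


section \<open>The Markov and the non-arithmeticity assumptions\<close>

definition top_transitive :: "(real^'n) set \<Rightarrow> (real^'n \<Rightarrow> real^'n) \<Rightarrow> bool" where
  "top_transitive I T \<longleftrightarrow> (\<exists>x\<in>I. closure (range (\<lambda>n. (T ^^ n) x)) = I)"

text \<open>
  Uniform contraction carries a multiplicative constant \<open>C\<close>. With \<open>C = 1\<close> it cannot hold for the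
  Brun algorithm (nor for the Gauss map): the branch \<open>h y = (1, y\<^sub>1, \<dots>, y\<^sub>m\<^sub>-\<^sub>1) / (1 + y\<^sub>m)\<close> of
  depth one multiplies the distance of points with equal last coordinate \<open>\<epsilon>\<close> by \<open>1 / (1 + \<epsilon>)\<close>,
  where \<open>\<epsilon> > 0\<close> is arbitrary.
\<close>

definition uniformly_contracting ::
  "(real^'n) set \<Rightarrow> (real^'n \<Rightarrow> real^'n) \<Rightarrow> 'j set \<Rightarrow> ('j \<Rightarrow> (real^'n) set) \<Rightarrow> bool" where
  "uniformly_contracting I T J D \<longleftrightarrow>
     (\<exists>C \<rho>. 0 < C \<and> 0 < \<rho> \<and> \<rho> < 1 \<and>
        (\<forall>js \<in> admissible_words I T J D.
           \<forall>x \<in> branch_dom I T D js. \<forall>y \<in> branch_dom I T D js.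
             norm (inv_branch T D js x - inv_branch T D js y) \<le> C * \<rho> ^ length js * norm (x - y)))"

text \<open>Differentiability is demanded so that \<open>jacobian\<close> is meaningful.\<close>

definition bounded_distortion ::
  "(real^'n) set \<Rightarrow> (real^'n \<Rightarrow> real^'n) \<Rightarrow> 'j set \<Rightarrow> ('j \<Rightarrow> (real^'n) set) \<Rightarrow> bool" where
  "bounded_distortion I T J D \<longleftrightarrow>
     (\<exists>M>0. \<forall>js \<in> admissible_words I T J D.
        (\<forall>x \<in> branch_dom I T D js. inv_branch T D js differentiable (at x)) \<and>
        (\<forall>x \<in> branch_dom I T D js. \<forall>y \<in> branch_dom I T D js.
           \<bar>jacobian (inv_branch T D js) x / jacobian (inv_branch T D js) y - 1\<bar> \<le> M * norm (x - y)))"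

text \<open>
  The image \<open>T ` D j\<close> of an open branch domain is open, so it is its closure that is required to be
  a union of closures of atoms. The set \<open>h\<^sub>j(P\<^sub>a)\<close> is the image of the part of \<open>P\<^sub>a\<close> on which the
  inverse branch \<open>h\<^sub>j\<close> is defined.
\<close>

definition markov_partition ::
  "(real^'n) set \<Rightarrow> (real^'n \<Rightarrow> real^'n) \<Rightarrow> 'j set \<Rightarrow> ('j \<Rightarrow> (real^'n) set) \<Rightarrow> bool" where
  "markov_partition I T J D \<longleftrightarrow>
     (\<exists>(A :: nat set) P.
        finite A \<and> open_partition I A P \<and> I = (\<Union>a\<in>A. closure (P a)) \<and>
        (\<forall>j\<in>J. \<exists>B\<subseteq>A. closure (T ` D j) = (\<Union>a\<in>B. closure (P a))) \<and>
        (\<forall>j\<in>J. \<forall>a\<in>A. D j \<inter> P a \<noteq> {} \<longrightarrow> D j \<subseteq> P a) \<and>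
        (\<forall>j\<in>J. \<forall>a\<in>A.
           (\<exists>!b. b \<in> A \<and> inv_into (D j) T ` (P a \<inter> T ` D j) \<subseteq> P b \<inter> D j) \<or>
           inv_into (D j) T ` (P a \<inter> T ` D j) \<inter> I = {}))"

definition markov_assumption ::
  "(real^'n) set \<Rightarrow> (real^'n \<Rightarrow> real^'n) \<Rightarrow> 'j set \<Rightarrow> ('j \<Rightarrow> (real^'n) set) \<Rightarrow> bool" where
  "markov_assumption I T J D \<longleftrightarrow>
     top_transitive I T \<and>
     uniformly_contracting I T J D \<and>
     bounded_distortion I T J D \<and>
     markov_partition I T J D"

definition non_arithmetic ::
  "(real^'n) set \<Rightarrow> (real^'n \<Rightarrow> real^'n) \<Rightarrow> 'j set \<Rightarrow> ('j \<Rightarrow> (real^'n) set) \<Rightarrow> bool" where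
  "non_arithmetic I T J D \<longleftrightarrow>
     \<not> (\<exists>c::real.
          {- ln \<bar>jacobian (inv_branch T D js) x\<bar> | js x.
             js \<in> admissible_words I T J D \<and> x \<in> I \<and> x \<in> branch_dom I T D js \<and>
             inv_branch T D js x = x}
          \<subseteq> range (\<lambda>z::int. c * of_int z))"


section \<open>The Brun algorithm\<close>

text \<open>
  The coordinates of \<open>real^'n\<close> are indexed by a finite linear order; \<open>pos\<close> and \<open>idx\<close> are the
  order isomorphism with \<open>{1..m}\<close>, \<open>m = CARD('n)\<close>, and its inverse.
\<close>

definition pos :: "'n::{finite,linorder} \<Rightarrow> nat" where
  "pos p = card {..p}"

definition idx :: "nat \<Rightarrow> 'n::{finite,linorder}" where
  "idx k = (THE p. pos p = k)"

text \<open>If the maximal coordinate is not unique, the first one is taken.\<close>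

definition max_index :: "real^'n::{finite,linorder} \<Rightarrow> 'n" where
  "max_index x = (LEAST i. \<forall>l. x $ l \<le> x $ i)"

definition brun :: "real^'n::{finite,linorder} \<Rightarrow> real^'n::{finite,linorder}" where
  "brun x =
     (let m = CARD('n::{finite,linorder}); i = max_index x in
      if x $ i = 0 then 0
      else (\<chi> p.
        if pos i + pos p \<le> m then x $ idx (pos i + pos p) / x $ i
        else if pos i + pos p = m + 1 then frac (1 / x $ i)
        else x $ idx (pos i + pos p - (m + 1)) / x $ i))"

definition unit_cube :: "(real^'n) set" where
  "unit_cube = {x. \<forall>l. 0 \<le> x $ l \<and> x $ l \<le> 1}"

text \<open>The branch \<open>(i, k)\<close>: the \<open>i\<close>-th coordinate is the largest one and \<open>\<lfloor>1 / x\<^sub>i\<rfloor> = k\<close>.\<close>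

definition brun_branches :: "('n \<times> nat) set" where
  "brun_branches = UNIV \<times> {1..}"

definition brun_dom :: "'n \<times> nat \<Rightarrow> (real^'n) set" where
  "brun_dom = (\<lambda>(i, k).
     {x. (\<forall>l. 0 < x $ l) \<and> (\<forall>l. l \<noteq> i \<longrightarrow> x $ l < x $ i) \<and>
         1 / (real k + 1) < x $ i \<and> x $ i < 1 / real k})"

end

theory Submission
  imports Defs
begin

text \<open>
  Every branch of the Brun algorithm is full: \<open>T\<close> maps each \<open>D j\<close> bijectively onto the open unit
  cube (lemma \<open>bij_brun_dom\<close>). Hence words of branches are admissible without restriction, every
  inverse branch lives on the whole open cube, and the partition with the open cube as its only
  atom is a Markov partition. What needs an argument is uniform contraction and, to a lesser
  extent, distortion, transitivity and non-arithmeticity.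

  \<^emph>\<open>Homogeneous coordinates.\<close> Write a point as \<open>(X\<^sub>0, X\<^sub>1, \<dots>, X\<^sub>m)\<close> with \<open>x\<^sub>l = X\<^sub>l / X\<^sub>0\<close>. If the cyclic
  relabelling performed by the algorithm is undone, the largest coordinate sits at some position \<open>s\<close>,
  and a branch \<open>(i, k)\<close> subtracts \<open>k\<close> times the next largest coordinate, at a position \<open>s' \<noteq> s\<close>, from
  it; then \<open>s'\<close> is the position of the largest one. So an inverse branch of depth \<open>n\<close> is a product
  of \<open>n\<close> elementary integer matrices, and each of its rows evolves by \<open>f s' := f s' + k * f s\<close>
  (lemma \<open>word_inverse_pairing\<close>).

  \<^emph>\<open>Contraction.\<close> Let \<open>w\<close> be the sum of all rows and \<open>g\<close> one row. Then \<open>w s\<close> is the largest weight,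
  \<open>g / w\<close> takes values in \<open>[0, 1]\<close>, and a step replaces the ratio at \<open>s'\<close> by a convex combination that
  puts at least half of its mass on the ratio at \<open>s\<close>. The inverse branch is Lipschitz with constant
  of the order of the largest minor \<open>w p * w q * \<bar>g p / w p - g q / w q\<bar>\<close> divided by \<open>(w s)\<^sup>2\<close>.
  After many steps these minors are small, uniformly over all words: either every position
  is visited again and again, and then all ratios approach each other; or some position is not
  visited for a long time, and then its weight is negligible and there is one position less to
  care about. This is an induction on the number of positions (lemma \<open>uniformly_clustered\<close>). So
  words of some fixed length \<open>L\<close> contract by \<open>1 / 2\<close>, and the composition of such blocks contracts
  exponentially (lemma \<open>word_inverse_exponential\<close>).

  \<^emph>\<open>Distortion.\<close> The Jacobian of a projective map with a matrix of determinant \<open>\<plusminus>1\<close> is \<open>\<plusminus>1\<close> over the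
  \<open>(m + 1)\<close>-th power of the denominator. The denominator is a linear form with nonnegative
  coefficients, of which the constant one is the largest, and so its logarithm is Lipschitz
  uniformly in the word.

  \<^emph>\<open>Transitivity\<close> follows from Baire's theorem, because short cylinders are dense and each of them
  is mapped onto the open cube. \<^emph>\<open>Non-arithmeticity\<close> comes from the fixed points of the branches
  \<open>(1, k)\<close>: their values \<open>- ln \<bar>J\<bar>\<close> are \<open>- (m + 1) * ln t\<^sub>k\<close> with \<open>1 / (k + 1) < t\<^sub>k < 1 / k\<close>, and
  consecutive ones have distinct values whose distance tends to \<open>0\<close>.
\<close>

section \<open>Rows along a sequence of subtractive steps\<close>

text \<open>
  A pair \<open>(p, k)\<close> in a path is the step in which \<open>p\<close> becomes the position of the largest coordinate
  after \<open>k\<close> times the coordinate at \<open>p\<close> has been subtracted from the coordinate at the previous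
  position \<open>s\<close>. Inverting it, \<open>X s\<close> becomes \<open>X s + k * X p\<close>; the recursion below is the transposed
  action on a linear form with coefficients \<open>f\<close>.
\<close>

primrec row_run :: "'p \<Rightarrow> ('p \<times> nat) list \<Rightarrow> ('p \<Rightarrow> real) \<Rightarrow> 'p \<Rightarrow> real" where
  "row_run s [] f = f"
| "row_run s (a # ps) f = row_run (fst a) ps (f(fst a := f (fst a) + real (snd a) * f s))"

primrec final_pos :: "'p \<Rightarrow> ('p \<times> nat) list \<Rightarrow> 'p" where
  "final_pos s [] = s"
| "final_pos s (a # ps) = final_pos (fst a) ps"

primrec alternating :: "'p \<Rightarrow> ('p \<times> nat) list \<Rightarrow> bool" where
  "alternating s [] = True"
| "alternating s (a # ps) = (fst a \<noteq> s \<and> 1 \<le> snd a \<and> alternating (fst a) ps)"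

lemma row_run_append: "row_run s (ps @ qs) f = row_run (final_pos s ps) qs (row_run s ps f)"
  by (induction ps arbitrary: s f) auto

lemma final_pos_append: "final_pos s (ps @ qs) = final_pos (final_pos s ps) qs"
  by (induction ps arbitrary: s) auto

lemma alternating_append:
  "alternating s (ps @ qs) \<longleftrightarrow> alternating s ps \<and> alternating (final_pos s ps) qs"
  by (induction ps arbitrary: s) auto

lemma row_run_unvisited: "q \<notin> fst ` set ps \<Longrightarrow> row_run s ps f q = f q"
  by (induction ps arbitrary: s f) auto

text \<open>
  The invariant of a path that stays in \<open>R\<close>: the current position carries the largest weight, and
  the ratios \<open>g p / w p\<close> are defined and lie in \<open>[0, 1]\<close>.
\<close>

definition weights_on :: "'p set \<Rightarrow> 'p \<Rightarrow> ('p \<Rightarrow> real) \<Rightarrow> ('p \<Rightarrow> real) \<Rightarrow> bool" where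
  "weights_on R s w g \<longleftrightarrow>
     s \<in> R \<and> (\<forall>p\<in>R. 0 < w p \<and> w p \<le> w s \<and> 0 \<le> g p \<and> g p \<le> w p)"

abbreviation grow :: "'p \<Rightarrow> 'p \<times> nat \<Rightarrow> ('p \<Rightarrow> real) \<Rightarrow> 'p \<Rightarrow> real" where
  "grow s a f \<equiv> f(fst a := f (fst a) + real (snd a) * f s)"

lemma weights_on_grow:
  assumes "weights_on R s w g" "fst a \<in> R" "1 \<le> snd a"
  shows "weights_on R (fst a) (grow s a w) (grow s a g)"
proof -
  have sR: "s \<in> R" and w: "\<And>p. p \<in> R \<Longrightarrow> 0 < w p \<and> w p \<le> w s \<and> 0 \<le> g p \<and> g p \<le> w p"
    using assms by (auto simp: weights_on_def)
  have k: "1 \<le> real (snd a)" using assms by simp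
  have 1: "w s \<le> real (snd a) * w s"
    using k w[OF sR] by (metis less_imp_le mult_le_cancel_right1 not_less)
  have 2: "real (snd a) * g s \<le> real (snd a) * w s" "0 \<le> real (snd a) * g s"
    using w[OF sR] by (auto intro!: mult_left_mono)
  define W where "W = real (snd a) * w s"
  define G where "G = real (snd a) * g s"
  have "w s \<le> W" "G \<le> W" "0 \<le> G" using 1 2 by (auto simp only: W_def G_def)
  then show ?thesis using assms(2) w[OF assms(2)] w[OF sR]
    unfolding weights_on_def W_def[symmetric] G_def[symmetric] by (fastforce dest: w)
qed

lemma weights_on_run:
  assumes "weights_on R s w g" "alternating s ps" "fst ` set ps \<subseteq> R"
  shows "weights_on R (final_pos s ps) (row_run s ps w) (row_run s ps g)"
  using assms
proof (induction ps arbitrary: s w g)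
  case (Cons a ps)
  then have "weights_on R (fst a) (grow s a w) (grow s a g)" by (intro weights_on_grow) auto
  then show ?case using Cons by auto
qed simp

text \<open>
  The weight added in one step is at least the largest weight, hence at least the average one.
\<close>

lemma sum_row_run_ge:
  assumes "finite R" "weights_on R s w g" "alternating s ps" "fst ` set ps \<subseteq> R"
  shows "(1 + 1 / card R) ^ length ps * sum w R \<le> sum (row_run s ps w) R"
  using assms(2-)
proof (induction ps arbitrary: s w g)
  case (Cons a ps)
  have sR: "s \<in> R" and w: "\<And>p. p \<in> R \<Longrightarrow> 0 < w p \<and> w p \<le> w s"
    using Cons.prems by (auto simp: weights_on_def)
  have aR: "fst a \<in> R" using Cons.prems by auto
  have "sum w R \<le> card R * w s" using w sum_bounded_above[of R w "w s"] by simp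
  moreover have "card R > 0" using assms(1) sR by (auto simp: card_gt_0_iff)
  ultimately have "(1 / card R) * sum w R \<le> w s" by (simp add: field_simps)
  also have "\<dots> \<le> real (snd a) * w s"
    using w[OF sR] Cons.prems(2) by (simp add: mult_le_cancel_right1)
  finally have "(1 + 1 / card R) * sum w R \<le> sum w R + real (snd a) * w s"
    by (simp add: algebra_simps)
  also have "\<dots> = sum (grow s a w) R"
    using aR assms(1) by (simp add: sum.remove)
  finally have 1: "(1 + 1 / card R) * sum w R \<le> sum (grow s a w) R" .
  have "(1 + 1 / card R) ^ length (a # ps) * sum w R
      = (1 + 1 / card R) ^ length ps * ((1 + 1 / card R) * sum w R)" by simp
  also have "\<dots> \<le> (1 + 1 / card R) ^ length ps * sum (grow s a w) R"
    using 1 by (intro mult_left_mono) auto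
  also have "\<dots> \<le> sum (row_run (fst a) ps (grow s a w)) R"
    using Cons.prems by (intro Cons.IH[where g = "grow s a g"] weights_on_grow) auto
  finally show ?case by simp
qed simp

text \<open>
  The weight of an unvisited position stays constant while the total weight, and with it the
  largest weight, grows exponentially.
\<close>

lemma unvisited_weight_small:
  assumes "finite R" "weights_on R s w g" "alternating s ps" "fst ` set ps \<subseteq> R"
    and "q \<in> R" "q \<notin> fst ` set ps"
  shows "(1 + 1 / card R) ^ length ps * row_run s ps w q
       \<le> card R * row_run s ps w (final_pos s ps)"
proof -
  have "weights_on R (final_pos s ps) (row_run s ps w) (row_run s ps g)"
    using assms by (intro weights_on_run) auto
  then have "sum (row_run s ps w) R \<le> card R * row_run s ps w (final_pos s ps)"
    unfolding weights_on_def using sum_bounded_above[of R "row_run s ps w"] by simp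
  moreover have "w q \<le> sum w R"
    using assms by (intro member_le_sum) (auto simp: weights_on_def intro: less_imp_le)
  ultimately show ?thesis
    using sum_row_run_ge[OF assms(1-4)] row_run_unvisited[OF assms(6), of s w]
    by (smt (verit, best) mult_left_mono zero_le_power divide_nonneg_nonneg of_nat_0_le_iff)
qed

text \<open>
  The new ratio at the visited position is a mediant. The old ratio at this position has a share
  \<open>1 - t\<close> of at most one half, since the previous position has the larger weight; the share is tiny
  if the position had a tiny relative weight.
\<close>

lemma grow_ratio:
  assumes "weights_on R s w g" "fst a \<in> R" "fst a \<noteq> s" "1 \<le> snd a"
  obtains t where "1/2 \<le> t" "t \<le> 1" "1 - t \<le> w (fst a) / w s"
    "grow s a g (fst a) / grow s a w (fst a) = (1 - t) * (g (fst a) / w (fst a)) + t * (g s / w s)"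
proof -
  define W where "W = real (snd a) * w s"
  define t where "t = W / (w (fst a) + W)"
  have w: "0 < w s" "0 < w (fst a)" "w (fst a) \<le> w s" using assms by (auto simp: weights_on_def)
  have kw: "w s \<le> W" using w assms(4) by (simp add: W_def mult_le_cancel_right1)
  then have pos: "0 < w (fst a) + W" using w by linarith
  have omt: "1 - t = w (fst a) / (w (fst a) + W)" using pos unfolding t_def by (simp add: field_simps)
  have "1/2 \<le> t" unfolding t_def using pos kw w by (simp add: pos_le_divide_eq)
  moreover have "t \<le> 1" unfolding t_def using pos w by simp
  moreover have "1 - t \<le> w (fst a) / w s" unfolding omt using w kw by (intro divide_left_mono mult_pos_pos) auto
  moreover have "grow s a g (fst a) / grow s a w (fst a) = (1 - t) * (g (fst a) / w (fst a)) + t * (g s / w s)"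
    unfolding omt unfolding t_def using w pos by (simp add: add_divide_distrib W_def)
  ultimately show ?thesis by (rule that)
qed

section \<open>Uniform clustering of the ratios\<close>

text \<open>
  Two positions may have ratios further apart than \<open>d\<close> only if one of them has a small relative
  weight; this makes all \<open>2 \<times> 2\<close> minors of the two rows small.
\<close>

definition clustered :: "real \<Rightarrow> 'p set \<Rightarrow> 'p \<Rightarrow> ('p \<Rightarrow> real) \<Rightarrow> ('p \<Rightarrow> real) \<Rightarrow> bool" where
  "clustered d R s w g \<longleftrightarrow>
     (\<forall>p\<in>R. \<forall>q\<in>R. d * w s < w p \<longrightarrow> d * w s < w q \<longrightarrow> \<bar>g p / w p - g q / w q\<bar> \<le> d)"

text \<open>
  The set \<open>K\<close> collects the positions whose ratios lie in a short interval. A position outside \<open>K\<close> has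
  small relative weight, and this weight only shrinks until the position is visited. At its first
  visit its ratio jumps to distance at most \<open>d\<close> from the ratio at the current position, which belongs to
  \<open>K\<close>, and so it joins \<open>K\<close> at the price of \<open>d\<close> in the length of the interval. This happens at
  most once for each position, which bounds the total loss independently of the length of the path.
\<close>

lemma cluster_persists:
  fixes d :: real
  assumes "finite R" "0 \<le> d" "weights_on R s w g" "alternating s ps" "fst ` set ps \<subseteq> R"
    and "K \<subseteq> R" "s \<in> K" "\<And>p. p \<in> K \<Longrightarrow> lo \<le> g p / w p \<and> g p / w p \<le> hi"
    and "hi - lo \<le> d * card K" "\<And>p. p \<in> R - K \<Longrightarrow> w p \<le> d * w s"
  shows "clustered (card R * d) R (final_pos s ps) (row_run s ps w) (row_run s ps g)"
  using assms(3-)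
proof (induction ps arbitrary: s w g K lo hi)
  case Nil
  have cK: "card K \<le> card R" "1 \<le> card R"
    using Nil assms(1) card_mono[of R K] by (auto simp: Suc_le_eq card_gt_0_iff weights_on_def)
  have ws: "0 < w s" using Nil by (auto simp: weights_on_def)
  have inK: "p \<in> K" if "p \<in> R" "card R * d * w s < w p" for p
  proof (rule ccontr)
    assume "p \<notin> K"
    then have "w p \<le> d * w s" using that Nil by auto
    also have "\<dots> \<le> card R * (d * w s)"
      using cK ws assms(2) mult_right_mono[of 1 "real (card R)" "d * w s"] by simp
    finally show False using that by (simp add: mult.assoc)
  qed
  have "hi - lo \<le> card R * d"
    using Nil.prems(7) cK assms(2) mult_left_mono[of "real (card K)" "card R" d] by (simp add: mult.commute)
  moreover have "\<bar>g p / w p - g q / w q\<bar> \<le> hi - lo" if "p \<in> K" "q \<in> K" for p q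
    using Nil.prems(6)[OF that(1)] Nil.prems(6)[OF that(2)] by (auto simp: abs_le_iff)
  ultimately show ?case unfolding clustered_def
    using inK by (auto intro: order_trans)
next
  case (Cons a ps)
  let ?j = "fst a"
  have jR: "?j \<in> R" and js: "?j \<noteq> s" "1 \<le> snd a" using Cons.prems by auto
  obtain t where t: "1/2 \<le> t" "t \<le> 1" "1 - t \<le> w ?j / w s"
    "grow s a g ?j / grow s a w ?j = (1 - t) * (g ?j / w ?j) + t * (g s / w s)"
    using grow_ratio[OF Cons.prems(1) jR js] by blast
  have W: "weights_on R ?j (grow s a w) (grow s a g)"
    using Cons.prems jR js by (intro weights_on_grow) auto
  have ws: "0 < w s" "s \<in> R" using Cons.prems by (auto simp: weights_on_def)
  have "w s \<le> grow s a w ?j" using W ws js unfolding weights_on_def by (metis fun_upd_other)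
  then have "d * w s \<le> d * grow s a w ?j" using assms(2) by (rule mult_left_mono)
  then have small: "grow s a w p \<le> d * grow s a w ?j" if "p \<in> R - insert ?j K" for p
    using that Cons.prems(8)[of p] by (auto simp del: fun_upd_same)
  have vs: "lo \<le> g s / w s" "g s / w s \<le> hi" using Cons.prems by auto
  have K: "\<And>p. p \<in> K - {?j} \<Longrightarrow> lo \<le> grow s a g p / grow s a w p \<and> grow s a g p / grow s a w p \<le> hi"
    using Cons.prems(6) by auto
  show ?case
  proof (cases "?j \<in> K")
    case True
    have "lo \<le> (1 - t) * (g ?j / w ?j) + t * (g s / w s)"
      "(1 - t) * (g ?j / w ?j) + t * (g s / w s) \<le> hi"
      using convex_bound_le[of "g ?j / w ?j" hi "g s / w s" "1 - t" t]
        convex_bound_le[of "- (g ?j / w ?j)" "- lo" "- (g s / w s)" "1 - t" t]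
        Cons.prems(6)[OF True] vs t by auto
    then have hull: "lo \<le> grow s a g p / grow s a w p \<and> grow s a g p / grow s a w p \<le> hi"
      if "p \<in> K" for p using K[of p] t(4) that by (cases "p = ?j") (auto simp del: fun_upd_apply)
    have "clustered (card R * d) R (final_pos ?j ps) (row_run ?j ps (grow s a w)) (row_run ?j ps (grow s a g))"
      using Cons.prems True W small hull
      by (intro Cons.IH[where K = K and lo = lo and hi = hi]) (auto simp: insert_absorb simp del: fun_upd_apply)
    then show ?thesis by simp
  next
    case False
    let ?v = "grow s a g ?j / grow s a w ?j"
    have wj: "0 < w ?j" "w ?j \<le> d * w s" "0 \<le> g ?j" "g ?j \<le> w ?j" "0 \<le> g s" "g s \<le> w s"
      using Cons.prems jR ws False by (auto simp: weights_on_def)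
    have "w ?j / w s \<le> d" using wj ws by (simp add: field_simps)
    then have td: "1 - t \<le> d" using t by simp
    have "\<bar>g ?j / w ?j - g s / w s\<bar> \<le> 1"
      using wj ws by (smt (verit, best) divide_le_eq_1_pos divide_nonneg_pos)
    then have "(1 - t) * \<bar>g ?j / w ?j - g s / w s\<bar> \<le> d * 1"
      using td t by (intro mult_mono) auto
    moreover have "(1 - t) * x + t * y - y = (1 - t) * (x - y)" for x y :: real
      by (simp add: algebra_simps)
    then have "?v - g s / w s = (1 - t) * (g ?j / w ?j - g s / w s)" unfolding t(4) .
    ultimately have close: "\<bar>?v - g s / w s\<bar> \<le> d" using t by (simp add: abs_mult)
    have finK: "finite K" using Cons.prems(4) assms(1) finite_subset by blast
    have wid: "max hi ?v - min lo ?v \<le> d * card (insert ?j K)"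
      using close vs Cons.prems(7) False finK assms(2) by (auto simp: algebra_simps max_def min_def)
    have hull: "min lo ?v \<le> grow s a g p / grow s a w p \<and> grow s a g p / grow s a w p \<le> max hi ?v"
      if "p \<in> insert ?j K" for p
      using K[of p] that by (cases "p = ?j") (auto simp: min_le_iff_disj le_max_iff_disj)
    have "clustered (card R * d) R (final_pos ?j ps) (row_run ?j ps (grow s a w)) (row_run ?j ps (grow s a g))"
      using Cons.prems jR W small hull wid
      by (intro Cons.IH[where K = "insert ?j K" and lo = "min lo ?v" and hi = "max hi ?v"]) (auto simp del: fun_upd_apply)
    then show ?thesis by simp
  qed
qed

lemma clustered_persists:
  fixes d :: real
  assumes "finite R" "0 < d" "d < 1" "weights_on R s w g" "alternating s ps" "fst ` set ps \<subseteq> R"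
    and "clustered d R s w g"
  shows "clustered (card R * d) R (final_pos s ps) (row_run s ps w) (row_run s ps g)"
proof -
  define K where "K = {p \<in> R. d * w s < w p}"
  define v where "v = (\<lambda>p. g p / w p)"
  have s: "s \<in> K" using assms(2-4) by (auto simp: K_def weights_on_def)
  have K: "finite K" "K \<noteq> {}" using s assms(1) by (auto simp: K_def)
  have "Max (v ` K) \<in> v ` K" "Min (v ` K) \<in> v ` K" using K by auto
  then have "Max (v ` K) - Min (v ` K) \<le> d"
    using assms(7) unfolding clustered_def K_def by (fastforce simp: abs_le_iff v_def)
  also have "d \<le> d * card K" using K assms(2) by (simp add: mult_le_cancel_left1 Suc_le_eq card_gt_0_iff)
  finally show ?thesis
    using assms s K
    by (intro cluster_persists[where K = K and lo = "Min (v ` K)" and hi = "Max (v ` K)"])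
       (auto simp: K_def fun_cong[OF v_def, symmetric])
qed

text \<open>
  Here \<open>V\<close> contains the positions visited so far and \<open>[a, b]\<close> their ratios. A visited position receives
  at least half of its new ratio from a position in \<open>V\<close>, so that the distances from the ends of
  \<open>[lo, hi]\<close> are at worst halved in every step. If all of \<open>R\<close> is visited, this improves the bounds \<open>lo\<close>
  and \<open>hi\<close> for all ratios.
\<close>

lemma visited_ratios_contract:
  assumes "weights_on R s w g" "alternating s ps" "fst ` set ps \<subseteq> R" "V \<subseteq> R" "s \<in> V"
    and "lo \<le> a" "b \<le> hi"
    and "\<And>p. p \<in> R \<Longrightarrow> lo \<le> g p / w p \<and> g p / w p \<le> hi"
    and "\<And>p. p \<in> V \<Longrightarrow> a \<le> g p / w p \<and> g p / w p \<le> b"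
    and "p \<in> V \<union> fst ` set ps"
  shows "lo + (1/2) ^ length ps * (a - lo) \<le> row_run s ps g p / row_run s ps w p \<and>
         row_run s ps g p / row_run s ps w p \<le> hi - (1/2) ^ length ps * (hi - b)"
  using assms
proof (induction ps arbitrary: s w g V a b)
  case (Cons e ps)
  let ?j = "fst e" and ?w = "grow s e w" and ?g = "grow s e g"
  have jR: "?j \<in> R" and js: "?j \<noteq> s" "1 \<le> snd e" using Cons.prems by auto
  obtain t where t: "1/2 \<le> t" "t \<le> 1"
    "?g ?j / ?w ?j = (1 - t) * (g ?j / w ?j) + t * (g s / w s)"
    using grow_ratio[OF Cons.prems(1) jR js] by blast
  have vs: "a \<le> g s / w s" "g s / w s \<le> b" and vj: "lo \<le> g ?j / w ?j" "g ?j / w ?j \<le> hi"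
    using Cons.prems jR by auto
  let ?a = "lo + (1/2) * (a - lo)" and ?b = "hi - (1/2) * (hi - b)"
  have "(1 - t) * lo + t * a \<le> (1 - t) * (g ?j / w ?j) + t * (g s / w s)"
    using vs vj t by (intro add_mono mult_left_mono) auto
  moreover have "(1/2) * (a - lo) \<le> t * (a - lo)" using t Cons.prems by (intro mult_right_mono) auto
  ultimately have l: "?a \<le> ?g ?j / ?w ?j" unfolding t(3) by (simp add: algebra_simps)
  have "(1 - t) * (g ?j / w ?j) + t * (g s / w s) \<le> (1 - t) * hi + t * b"
    using vs vj t by (intro add_mono mult_left_mono) auto
  moreover have "(1/2) * (hi - b) \<le> t * (hi - b)" using t Cons.prems by (intro mult_right_mono) auto
  ultimately have u: "?g ?j / ?w ?j \<le> ?b" unfolding t(3) by (simp add: algebra_simps)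
  have ab: "lo \<le> ?a" "?b \<le> hi" "?a \<le> a" "b \<le> ?b" using Cons.prems by (auto simp: field_simps)
  have V: "?a \<le> ?g p / ?w p \<and> ?g p / ?w p \<le> ?b" if "p \<in> insert ?j V" for p
  proof (cases "p = ?j")
    case False
    then have "a \<le> g p / w p \<and> g p / w p \<le> b" using that Cons.prems by auto
    then show ?thesis using False ab by auto
  qed (use l u in auto)
  have R: "lo \<le> ?g p / ?w p \<and> ?g p / ?w p \<le> hi" if "p \<in> R" for p
  proof (cases "p = ?j")
    case True
    show ?thesis using order_trans[OF ab(1) l] order_trans[OF u ab(2)] unfolding True by (rule conjI)
  qed (use Cons.prems that in auto)
  have "lo + (1/2) ^ length ps * (?a - lo) \<le> row_run ?j ps ?g p / row_run ?j ps ?w p \<and>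
        row_run ?j ps ?g p / row_run ?j ps ?w p \<le> hi - (1/2) ^ length ps * (hi - ?b)"
    using Cons.prems jR js ab V R
    by (intro Cons.IH[where V = "insert ?j V"] weights_on_grow) auto
  then show ?case by (simp add: field_simps)
qed auto

lemma clustered_small_weight:
  assumes "clustered d (R - {q}) s w g" "w q \<le> d * w s"
  shows "clustered d R s w g"
  unfolding clustered_def
proof (intro ballI impI)
  fix x y assume "x \<in> R" "y \<in> R" and xy: "d * w s < w x" "d * w s < w y"
  then have "x \<in> R - {q}" "y \<in> R - {q}" using assms(2) by auto
  then show "\<bar>g x / w x - g y / w y\<bar> \<le> d" using xy assms(1) by (simp add: clustered_def)
qed

text \<open>
  Induction on the number of positions. Cut the path into blocks whose length \<open>l\<close> is so large that the
  induction hypothesis applies to a block with one position less, with a smaller constant \<open>e\<close>. If all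
  positions are visited in a block, the oscillation of the ratios drops by the factor
  \<open>1 - (1 / 2) ^ l\<close>; a bounded number of such blocks suffices. If some position \<open>q\<close> is missed in a
  block, then its weight is small at the end of the block and the other positions are clustered by the
  induction hypothesis; from then on \<open>clustered_persists\<close> applies.
\<close>

lemma uniformly_clustered:
  assumes "0 < (d::real)"
  shows "\<exists>L. \<forall>R s ps w g. finite R \<longrightarrow> card R \<le> r \<longrightarrow> weights_on (R :: 'p set) s w g \<longrightarrow> alternating s ps \<longrightarrow>
           fst ` set ps \<subseteq> R \<longrightarrow> L \<le> length ps \<longrightarrow>
           clustered d R (final_pos s ps) (row_run s ps w) (row_run s ps g)"
  using assms
proof (induction r arbitrary: d)
  case 0
  show ?case by (auto simp: weights_on_def)
next
  case (Suc r)
  \<comment> \<open>Persistence multiplies the constant by \<open>card R \<le> Suc r\<close>, and it needs a constant below \<open>1\<close>.\<close>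
  define e where "e = min (d / Suc r) (1/2)"
  have e: "0 < e" "e < 1" using Suc.prems by (auto simp: e_def)
  have "e \<le> d / Suc r" unfolding e_def by (rule min.cobounded1)
  then have e3: "e * Suc r \<le> d" by (simp add: pos_le_divide_eq)
  obtain L where L: "\<And>R s ps w g. finite R \<Longrightarrow> card R \<le> r \<Longrightarrow> weights_on (R :: 'p set) s w g \<Longrightarrow>
      alternating s ps \<Longrightarrow> fst ` set ps \<subseteq> R \<Longrightarrow> L \<le> length ps \<Longrightarrow>
      clustered e R (final_pos s ps) (row_run s ps w) (row_run s ps g)"
    using Suc.IH[OF e(1)] by blast
  \<comment> \<open>\<open>L'\<close> makes the weight of a position that is missed in a whole block smaller than \<open>e\<close>.\<close>
  obtain L' where L': "Suc r / e < (1 + 1 / Suc r) ^ L'"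
    using real_arch_pow[of "1 + 1 / Suc r" "Suc r / e"] by auto
  define l where "l = max L L'"
  define c where "c = 1 - (1/2 :: real) ^ l"
  have c: "0 \<le> c" "c < 1" by (auto simp: c_def power_le_one)
  obtain K where K: "c ^ K < d" using real_arch_pow_inv[OF Suc.prems c(2)] by blast
  have mono: "clustered d R s w g" if "clustered (card R * e) R s w g" "card R \<le> Suc r" "weights_on R s w g"
    for R :: "'p set" and s w g
  proof -
    have "real (card R) * e \<le> Suc r * e" using that e by (intro mult_right_mono) auto
    then have le: "card R * e \<le> d" using e3 by (simp add: mult.commute)
    then have "card R * e * w s \<le> d * w s" using that by (intro mult_right_mono) (auto simp: weights_on_def intro: less_imp_le)
    then show ?thesis using that(1) le unfolding clustered_def by (meson le_less_trans order_trans)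
  qed
  have main: "clustered d R (final_pos s ps) (row_run s ps w) (row_run s ps g) \<or>
     (\<exists>lo hi. hi - lo \<le> c ^ n * D \<and> (\<forall>p\<in>R. lo \<le> row_run s ps g p / row_run s ps w p
         \<and> row_run s ps g p / row_run s ps w p \<le> hi))"
    if "finite R" "card R \<le> Suc r" "weights_on R s w g" "alternating s ps" "fst ` set ps \<subseteq> R" "n * l = length ps"
       "\<And>p. p \<in> R \<Longrightarrow> lo \<le> g p / w p \<and> g p / w p \<le> hi" "hi - lo \<le> D"
    for R :: "'p set" and n D s ps w g lo hi
    using that(3-)
  proof (induction n arbitrary: s ps w g lo hi D)
    case 0
    then show ?case by auto
  next
    case (Suc n)
    define qs where "qs = take l ps"
    define rs where "rs = drop l ps"
    have ps: "ps = qs @ rs" by (simp add: qs_def rs_def)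
    have lq: "length qs = l" "n * l = length rs" using Suc.prems(4) by (auto simp: qs_def rs_def)
    have v: "alternating s qs" "alternating (final_pos s qs) rs" "fst ` set qs \<subseteq> R" "fst ` set rs \<subseteq> R"
      using Suc.prems ps by (auto simp: alternating_append)
    have W: "weights_on R (final_pos s qs) (row_run s qs w) (row_run s qs g)"
      using Suc.prems v by (intro weights_on_run)
    show ?case
    proof (cases "R \<subseteq> {s} \<union> fst ` set qs")
      case True
      let ?v = "g s / w s"
      let ?lo = "lo + (1/2) ^ l * (?v - lo)" and ?hi = "hi - (1/2) ^ l * (hi - ?v)"
      have sR: "s \<in> R" using Suc.prems by (auto simp: weights_on_def)
      have "?lo \<le> row_run s qs g p / row_run s qs w p \<and> row_run s qs g p / row_run s qs w p \<le> ?hi"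
        if "p \<in> R" for p
      proof -
        have pin: "p \<in> {s} \<union> fst ` set qs" using True that by blast
        show ?thesis unfolding lq(1)[symmetric]
          using Suc.prems(1,5) v(1,3) sR pin
          by (intro visited_ratios_contract[where V = "{s}" and R = R]) auto
      qed
      moreover have "?hi - ?lo \<le> c * D"
      proof -
        have "?hi - ?lo = c * (hi - lo)" by (simp add: c_def algebra_simps)
        then show ?thesis using Suc.prems c by (simp add: mult_left_mono)
      qed
      ultimately have "clustered d R (final_pos (final_pos s qs) rs) (row_run (final_pos s qs) rs (row_run s qs w)) (row_run (final_pos s qs) rs (row_run s qs g)) \<or>
       (\<exists>lo hi. hi - lo \<le> c ^ n * (c * D)
           \<and> (\<forall>p\<in>R. lo \<le> row_run (final_pos s qs) rs (row_run s qs g) p / row_run (final_pos s qs) rs (row_run s qs w) p \<and> row_run (final_pos s qs) rs (row_run s qs g) p / row_run (final_pos s qs) rs (row_run s qs w) p \<le> hi))"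
        using W v lq by (intro Suc.IH) auto
      then show ?thesis by (simp add: ps row_run_append final_pos_append mult.left_commute mult.assoc)
    next
      case False
      then obtain q where q: "q \<in> R" "q \<noteq> s" "q \<notin> fst ` set qs" by auto
      have cR: "card (R - {q}) \<le> r" using that(1,2) q by simp
      have "weights_on (R - {q}) s w g" using Suc.prems(1) q by (auto simp: weights_on_def)
      then have cl: "clustered e (R - {q}) (final_pos s qs) (row_run s qs w) (row_run s qs g)"
        using v q lq cR that(1) by (intro L) (auto simp: l_def)
      have "(1 + 1 / card R) ^ l * row_run s qs w q \<le> card R * row_run s qs w (final_pos s qs)"
        using unvisited_weight_small[of R s w g qs q] that(1) Suc.prems v q lq by auto
      moreover have "Suc r / e \<le> (1 + 1 / card R) ^ l"
      proof -
        have "0 < card R" using q that(1) by (auto simp: card_gt_0_iff)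
        then have "(1 + 1 / Suc r) ^ L' \<le> (1 + 1 / card R) ^ L'"
          using that(2) by (intro power_mono add_left_mono divide_left_mono) auto
        also have "\<dots> \<le> (1 + 1 / card R) ^ l" by (intro power_increasing) (auto simp: l_def)
        finally show ?thesis using L' by simp
      qed
      moreover have pos: "0 < row_run s qs w q" "0 < row_run s qs w (final_pos s qs)"
        using W q unfolding weights_on_def by auto
      ultimately have "Suc r / e * row_run s qs w q \<le> Suc r * row_run s qs w (final_pos s qs)"
      proof -
        assume a: "(1 + 1 / card R) ^ l * row_run s qs w q \<le> card R * row_run s qs w (final_pos s qs)"
          "Suc r / e \<le> (1 + 1 / card R) ^ l"
        have "Suc r / e * row_run s qs w q \<le> (1 + 1 / card R) ^ l * row_run s qs w q"
          using a pos by (intro mult_right_mono) auto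
        also note a(1)
        also have "card R * row_run s qs w (final_pos s qs) \<le> Suc r * row_run s qs w (final_pos s qs)"
          using that(2) pos by (intro mult_right_mono) auto
        finally show ?thesis .
      qed
      then have "row_run s qs w q \<le> e * row_run s qs w (final_pos s qs)"
        using e(1) by (simp add: field_simps del: of_nat_Suc)
      with cl have "clustered e R (final_pos s qs) (row_run s qs w) (row_run s qs g)"
        by (rule clustered_small_weight)
      then have "clustered (card R * e) R (final_pos s ps) (row_run s ps w) (row_run s ps g)"
        unfolding ps row_run_append final_pos_append
        using e W v that(1) by (intro clustered_persists) auto
      moreover have "weights_on R (final_pos s ps) (row_run s ps w) (row_run s ps g)"
        using Suc.prems by (intro weights_on_run) auto
      ultimately show ?thesis using mono that(2) by blast
    qed
  qed
  have "clustered d R (final_pos s ps) (row_run s ps w) (row_run s ps g)"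
    if R: "finite R" "card R \<le> Suc r" "weights_on R s w g" "alternating s ps" "fst ` set ps \<subseteq> R" "K * l \<le> length ps"
    for R :: "'p set" and s ps w g
  proof -
    \<comment> \<open>The first steps, up to a multiple of the block length, only have to preserve the invariant.\<close>
    define qs where "qs = take (length ps - K * l) ps"
    define rs where "rs = drop (length ps - K * l) ps"
    have ps: "ps = qs @ rs" by (simp add: qs_def rs_def)
    have lr: "K * l = length rs" using R(6) by (simp add: rs_def)
    have v: "alternating s qs" "alternating (final_pos s qs) rs" "fst ` set qs \<subseteq> R" "fst ` set rs \<subseteq> R"
      using R ps by (auto simp: alternating_append)
    have W: "weights_on R (final_pos s qs) (row_run s qs w) (row_run s qs g)"
      using R v by (intro weights_on_run)
    then have 01: "0 \<le> row_run s qs g p / row_run s qs w p \<and> row_run s qs g p / row_run s qs w p \<le> 1"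
      if "p \<in> R" for p using that by (auto simp: weights_on_def)
    consider "clustered d R (final_pos s ps) (row_run s ps w) (row_run s ps g)"
      | lo hi where "hi - lo \<le> c ^ K * 1" "\<forall>p\<in>R. lo \<le> row_run s ps g p / row_run s ps w p
          \<and> row_run s ps g p / row_run s ps w p \<le> hi"
      using main[OF R(1,2) W v(2,4) lr 01, of 1] unfolding ps row_run_append final_pos_append by auto
    then show ?thesis
    proof cases
      case 2
      let ?v = "\<lambda>p. row_run s ps g p / row_run s ps w p"
      have "\<bar>?v p - ?v q\<bar> \<le> d" if "p \<in> R" "q \<in> R" for p q
        using 2(1) bspec[OF 2(2) that(1)] bspec[OF 2(2) that(2)] K by linarith
      then show ?thesis unfolding clustered_def by blast
    qed
  qed
  then show ?case by blast
qed

lemma clustered_minor_le: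
  assumes "clustered d R s w g" "weights_on R s w g" "0 \<le> d" "p \<in> R" "q \<in> R"
  shows "\<bar>g p * w q - g q * w p\<bar> \<le> d * (w s)\<^sup>2"
proof -
  have w: "0 < w p" "w p \<le> w s" "0 < w q" "w q \<le> w s" "0 \<le> g p" "g p \<le> w p" "0 \<le> g q" "g q \<le> w q"
    using assms by (auto simp: weights_on_def)
  have eq: "g p * w q - g q * w p = w p * w q * (g p / w p - g q / w q)" using w by (simp add: field_simps)
  have pq: "w p * w q \<le> w s * w s" using w by (intro mult_mono) auto
  have le1: "\<bar>g p * w q - g q * w p\<bar> \<le> w p * w q"
    using mult_right_mono[of "g p" "w p" "w q"] mult_right_mono[of "g q" "w q" "w p"] w
    by (smt (verit) mult.commute mult_nonneg_nonneg)
  consider "w p \<le> d * w s" | "w q \<le> d * w s" | "d * w s < w p" "d * w s < w q" by linarith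
  then show ?thesis
  proof cases
    case 1
    have "w p * w q \<le> (d * w s) * w s" using 1 w assms(3) by (intro mult_mono) auto
    then show ?thesis using le1 by (simp add: power2_eq_square mult.assoc)
  next
    case 2
    have "w p * w q \<le> w s * (d * w s)" using 2 w assms(3) by (intro mult_mono) auto
    then show ?thesis using le1 by (simp add: power2_eq_square mult_ac)
  next
    case 3
    then have "\<bar>g p / w p - g q / w q\<bar> \<le> d" using assms by (auto simp: clustered_def)
    then have "w p * w q * \<bar>g p / w p - g q / w q\<bar> \<le> (w s * w s) * d"
      using pq w by (intro mult_mono) auto
    then show ?thesis unfolding eq using w by (simp add: abs_mult power2_eq_square mult_ac)
  qed
qed

section \<open>The branches of the Brun algorithm\<close>

lemma pos_strict_mono: "p < q \<Longrightarrow> pos p < pos (q :: 'n::{finite,linorder})"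
  unfolding pos_def by (rule psubset_card_mono) auto

lemma pos_inj: "pos p = pos q \<longleftrightarrow> p = (q :: 'n::{finite,linorder})"
  by (metis less_irrefl neqE pos_strict_mono)

lemma pos_range: "1 \<le> pos p \<and> pos (p :: 'n::{finite,linorder}) \<le> CARD('n)"
  unfolding pos_def by (auto simp: Suc_le_eq card_gt_0_iff intro: card_mono)

lemma pos_image: "range (pos :: 'n::{finite,linorder} \<Rightarrow> nat) = {1..CARD('n)}"
proof (rule card_subset_eq)
  show "card (range (pos :: 'n \<Rightarrow> nat)) = card {1..CARD('n)}"
    by (simp add: card_image inj_def pos_inj)
  show "range (pos :: 'n \<Rightarrow> nat) \<subseteq> {1..CARD('n)}"
  proof clarify
    fix p :: 'n
    show "pos p \<in> {1..CARD('n)}" using pos_range[of p] by simp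
  qed
qed simp

lemma idx_pos [simp]: "idx (pos p) = (p :: 'n::{finite,linorder})"
  unfolding idx_def by (rule the_equality) (auto simp: pos_inj)

lemma pos_idx: "1 \<le> k \<Longrightarrow> k \<le> CARD('n) \<Longrightarrow> pos (idx k :: 'n::{finite,linorder}) = k"
  using pos_image[where 'n = 'n] by (metis atLeastAtMost_iff idx_pos imageE)

text \<open>
  The coordinate of \<open>T x\<close> that holds the fractional part, when \<open>x\<close> is largest at \<open>i\<close>.
\<close>

definition slot :: "'n \<Rightarrow> 'n::{finite,linorder}" where
  "slot i = idx (CARD('n) + 1 - pos i)"

text \<open>
  The coordinate \<open>p\<close> of \<open>T x\<close> is taken from coordinate \<open>turn i p\<close> of \<open>x\<close>. The fractional part at \<open>slot i\<close>
  stems from the coordinate \<open>0\<close> of the homogeneous vector; sending \<open>slot i\<close> to \<open>i\<close> instead turns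
  the relabelling into a permutation.
\<close>

definition turn :: "'n \<Rightarrow> 'n \<Rightarrow> 'n::{finite,linorder}" where
  "turn i p = (if pos i + pos p \<le> CARD('n) then idx (pos i + pos p)
               else if pos i + pos p = CARD('n) + 1 then i
               else idx (pos i + pos p - (CARD('n) + 1)))"

lemma slot_iff: "p = slot i \<longleftrightarrow> pos i + pos p = CARD('n::{finite,linorder}) + 1" for p i :: "'n::{finite,linorder}"
proof -
  have "pos (slot i) = CARD('n) + 1 - pos i"
    unfolding slot_def using pos_range[of i] by (intro pos_idx) auto
  then show ?thesis using pos_range[of i] pos_inj[of p "slot i"] by auto
qed

lemma turn_slot [simp]: "turn i (slot i) = i"
  using slot_iff[of "slot i" i] by (simp add: turn_def)

lemma pos_turn:
  "pos (turn i p) = (if pos i + pos p \<le> CARD('n::{finite,linorder}) then pos i + pos p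
     else if pos i + pos p = CARD('n) + 1 then pos i else pos i + pos p - (CARD('n) + 1))"
  for p i :: "'n::{finite,linorder}"
proof -
  have "1 \<le> pos i" "pos i \<le> CARD('n)" "1 \<le> pos p" "pos p \<le> CARD('n)"
    using pos_range by auto
  then show ?thesis unfolding turn_def by (auto intro!: pos_idx)
qed

lemma turn_permutes: "turn i permutes (UNIV :: 'n::{finite,linorder} set)"
proof (rule bij_imp_permutes)
  have "inj (turn i)"
  proof (rule injI)
    fix p q assume "turn i p = turn i q"
    then have "pos (turn i p) = pos (turn i q)" by simp
    then have "pos p = pos q"
      using pos_range[of i] pos_range[of p] pos_range[of q] unfolding pos_turn
      by (auto split: if_splits)
    then show "p = q" by (simp add: pos_inj)
  qed
  then show "bij_betw (turn i) UNIV UNIV" by (simp add: bij_def finite_UNIV_inj_surj)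
qed auto

lemma turn_eq_iff: "turn i p = i \<longleftrightarrow> p = slot i"
  using permutes_inj[OF turn_permutes] by (metis injD turn_slot)

definition unturn :: "'n \<Rightarrow> 'n \<Rightarrow> 'n::{finite,linorder}" where
  "unturn i = inv (turn i)"

lemma turn_unturn [simp]: "turn i (unturn i p) = p" "unturn i (turn i p) = p"
  unfolding unturn_def by (simp_all add: permutes_inverses[OF turn_permutes])

lemma unturn_permutes: "unturn i permutes UNIV"
  unfolding unturn_def by (rule permutes_inv[OF turn_permutes])

lemma unturn_eq_iff: "unturn i l = slot i \<longleftrightarrow> l = i"
  by (metis turn_slot turn_unturn)

definition open_cube :: "(real^'n) set" where
  "open_cube = {x. \<forall>l. 0 < x $ l \<and> x $ l < 1}"

lemma open_cube_eq: "open_cube = box 0 (\<chi> l. 1)"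
  by (auto simp: open_cube_def mem_box_cart)

lemma unit_cube_eq: "unit_cube = cbox 0 (\<chi> l. 1)"
  by (auto simp: unit_cube_def mem_box_cart)

lemma open_cube_subset: "open_cube \<subseteq> unit_cube"
  by (auto simp: open_cube_def unit_cube_def intro: less_imp_le)

lemma open_open_cube: "open open_cube" unfolding open_cube_eq by (rule open_box)

lemma closure_open_cube: "closure open_cube = (unit_cube :: (real^'n) set)"
proof -
  have "(\<chi> l. (1/2 :: real)) \<in> (open_cube :: (real^'n) set)" by (auto simp: open_cube_def)
  then have "box 0 (\<chi> l. 1) \<noteq> ({} :: (real^'n) set)" by (auto simp: open_cube_eq)
  then show ?thesis by (simp add: open_cube_eq unit_cube_eq closure_box)
qed

lemma diff_cube_le:
  fixes x y :: "real^'n"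
  assumes "x \<in> open_cube" "y \<in> open_cube"
  shows "norm (x - y) \<le> CARD('n)"
proof -
  have "norm (x - y) \<le> (\<Sum>l\<in>UNIV. \<bar>(x - y) $ l\<bar>)" by (rule norm_le_l1_cart)
  also have "\<dots> \<le> of_nat (card (UNIV :: 'n set)) * 1"
    using assms by (intro sum_bounded_above) (auto simp: open_cube_def abs_le_iff algebra_simps intro: less_imp_le add_mono, (smt (verit))+)
  finally show ?thesis by simp
qed

abbreviation denom :: "'n \<times> nat \<Rightarrow> real^'n::{finite,linorder} \<Rightarrow> real" where
  "denom j y \<equiv> real (snd j) + y $ slot (fst j)"

definition local_inverse :: "'n \<times> nat \<Rightarrow> real^'n::{finite,linorder} \<Rightarrow> real^'n::{finite,linorder}" where
  "local_inverse j y = (\<chi> l. (if l = fst j then 1 else y $ unturn (fst j) l) / denom j y)"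

text \<open>
  The branch of \<open>T\<close> on \<open>brun_dom j\<close>, as a map that is smooth wherever the coordinate \<open>fst j\<close>
  does not vanish; this is also its extension to the closure of the domain.
\<close>

definition branch_map :: "'n \<times> nat \<Rightarrow> real^'n::{finite,linorder} \<Rightarrow> real^'n::{finite,linorder}" where
  "branch_map j x = (\<chi> p. (if p = slot (fst j) then 1 - real (snd j) * x $ fst j else x $ turn (fst j) p) / x $ fst j)"

lemma max_index_eq: "(\<And>l. l \<noteq> i \<Longrightarrow> x $ l < x $ i) \<Longrightarrow> max_index x = i"
  unfolding max_index_def by (rule Least_equality) (metis less_le order_refl not_le)+

lemma max_index_max: "x $ l \<le> x $ max_index x"
proof -
  have "\<exists>i. \<forall>l. x $ l \<le> x $ i"
  proof -
    have "Max (range (($) x)) \<in> range (($) x)" by (rule Max_in) auto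
    then obtain i where i: "Max (range (($) x)) = x $ i" by (rule rangeE)
    have "x $ l \<le> x $ i" for l unfolding i[symmetric] by (rule Max_ge) auto
    then show ?thesis by blast
  qed
  then have "max_index x \<in> {i. \<forall>l. x $ l \<le> x $ i}"
    unfolding max_index_def by (subst Least_Min) (auto intro!: Min_in simp del: mem_Collect_eq)
  then show ?thesis by blast
qed

lemma brun_eq: "brun x = (let i = max_index x in if x $ i = 0 then 0 else
    (\<chi> p. if p = slot i then frac (1 / x $ i) else x $ turn i p / x $ i))"
  unfolding brun_def Let_def
  by (simp add: vec_eq_iff slot_iff turn_def) 

lemma brun_dom_iff:
  "x \<in> brun_dom j \<longleftrightarrow> (\<forall>l. 0 < x $ l) \<and> (\<forall>l. l \<noteq> fst j \<longrightarrow> x $ l < x $ fst j) \<and>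
         1 / (real (snd j) + 1) < x $ fst j \<and> x $ fst j < 1 / real (snd j)"
  unfolding brun_dom_def by (cases j) auto

lemma brun_on_dom:
  fixes x :: "real^'n::{finite,linorder}"
  assumes "x \<in> brun_dom j" "1 \<le> snd j"
  shows "brun x = branch_map j x"
proof -
  let ?i = "fst j" and ?k = "snd j"
  have x: "0 < x $ ?i" "1 / (real ?k + 1) < x $ ?i" "x $ ?i < 1 / real ?k"
    using assms by (auto simp: brun_dom_iff)
  have m: "max_index x = ?i" using assms by (intro max_index_eq) (auto simp: brun_dom_iff)
  have "real ?k < 1 / x $ ?i" "1 / x $ ?i < real ?k + 1" using x assms(2) by (auto simp: field_simps)
  then have "frac (1 / x $ ?i) = 1 / x $ ?i - real ?k"
    by (simp add: frac_unique_iff)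
  then show ?thesis using x(1) unfolding brun_eq m branch_map_def Let_def
    by (simp add: vec_eq_iff diff_divide_distrib)
qed

lemma denom_pos: "y \<in> open_cube \<Longrightarrow> 1 \<le> snd j \<Longrightarrow> 1 < denom j y"
  by (smt (verit) mem_Collect_eq of_nat_1 of_nat_le_iff open_cube_def)

lemma local_inverse_in_dom:
  assumes "y \<in> open_cube" "1 \<le> snd j"
  shows "local_inverse j y \<in> brun_dom j"
proof -
  have d: "1 < denom j y" using denom_pos[OF assms] .
  have y: "0 < y $ l" "y $ l < 1" for l using assms by (auto simp: open_cube_def)
  show ?thesis unfolding brun_dom_iff local_inverse_def
    using d y assms(2) by (auto simp: divide_simps intro!: add_pos_pos)
qed

lemma dom_subset_open_cube:
  assumes "1 \<le> snd j"
  shows "brun_dom j \<subseteq> open_cube"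
proof
  fix x assume x: "x \<in> brun_dom j"
  have "1 / real (snd j) \<le> 1" using assms by simp
  then have "x $ fst j < 1" using x by (auto simp: brun_dom_iff)
  then have "x $ l < 1" for l using x by (cases "l = fst j") (auto simp: brun_dom_iff intro: less_trans)
  then show "x \<in> open_cube" using x by (auto simp: open_cube_def brun_dom_iff)
qed

lemma local_inverse_in_cube: "y \<in> open_cube \<Longrightarrow> 1 \<le> snd j \<Longrightarrow> local_inverse j y \<in> open_cube"
  using local_inverse_in_dom dom_subset_open_cube by blast

lemma branch_map_local_inverse:
  assumes "y \<in> open_cube" "1 \<le> snd j"
  shows "branch_map j (local_inverse j y) = y"
proof -
  define d where "d = denom j y"
  have d: "d \<noteq> 0" "y $ slot (fst j) = d - real (snd j)"
    using denom_pos[OF assms] by (simp_all add: d_def)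
  have c: "local_inverse j y $ fst j = 1 / d" "p \<noteq> slot (fst j)
      \<Longrightarrow> local_inverse j y $ turn (fst j) p = y $ p / d" for p
    by (auto simp: local_inverse_def d_def turn_eq_iff)
  show ?thesis unfolding branch_map_def vec_eq_iff
    by (simp add: c) (use d in \<open>simp add: divide_simps; algebra\<close>)
qed

lemma local_inverse_branch_map:
  assumes "x \<in> brun_dom j" "1 \<le> snd j"
  shows "local_inverse j (branch_map j x) = x"
proof -
  have x: "0 < x $ fst j" using assms by (auto simp: brun_dom_iff)
  have "denom j (branch_map j x) = 1 / x $ fst j" using x by (simp add: branch_map_def field_simps)
  then show ?thesis using x unfolding local_inverse_def
    by (auto simp: vec_eq_iff field_simps branch_map_def unturn_eq_iff)
qed

lemma branch_map_in_cube:
  assumes "x \<in> brun_dom j" "1 \<le> snd j"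
  shows "branch_map j x \<in> open_cube"
proof -
  have x: "0 < x $ l" "l \<noteq> fst j \<Longrightarrow> x $ l < x $ fst j" for l using assms by (auto simp: brun_dom_iff)
  have k: "1 / (real (snd j) + 1) < x $ fst j" "x $ fst j < 1 / real (snd j)"
    using assms by (auto simp: brun_dom_iff)
  have "real (snd j) * x $ fst j < 1" "1 < (real (snd j) + 1) * x $ fst j"
    using k assms(2) by (auto simp: field_simps)
  moreover have "p \<noteq> slot (fst j) \<Longrightarrow> x $ turn (fst j) p < x $ fst j" for p
    using x(2)[of "turn (fst j) p"] by (simp add: turn_eq_iff)
  ultimately show ?thesis using x(1) unfolding open_cube_def branch_map_def
    by (auto simp: divide_simps algebra_simps)
qed

lemma brun_local_inverse: "y \<in> open_cube \<Longrightarrow> 1 \<le> snd j \<Longrightarrow> brun (local_inverse j y) = y"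
  using brun_on_dom[OF local_inverse_in_dom] branch_map_local_inverse by metis

lemma bij_brun_dom:
  assumes "1 \<le> snd j"
  shows "inj_on brun (brun_dom j)" "brun ` brun_dom j = open_cube"
proof -
  show "inj_on brun (brun_dom j)"
    by (rule inj_on_inverseI[of _ "local_inverse j"]) (simp add: brun_on_dom[OF _ assms] local_inverse_branch_map[OF _ assms])
  show "brun ` brun_dom j = open_cube"
  proof (intro equalityI subsetI)
    fix y assume "y \<in> brun ` brun_dom j"
    then show "y \<in> open_cube" using brun_on_dom[OF _ assms] branch_map_in_cube[OF _ assms] by auto
  next
    fix y :: "real^'a::{finite,linorder}" assume y: "y \<in> open_cube"
    show "y \<in> brun ` brun_dom j"
      using brun_local_inverse[OF y assms] local_inverse_in_dom[OF y assms] by (metis imageI)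
  qed
qed

lemma inv_into_brun:
  "y \<in> open_cube \<Longrightarrow> 1 \<le> snd j \<Longrightarrow> inv_into (brun_dom j) brun y = local_inverse j y"
  by (rule inv_into_f_eq[OF bij_brun_dom(1)]) (auto simp: local_inverse_in_dom brun_local_inverse)

section \<open>Words of inverse branches\<close>

primrec word_inverse :: "('n \<times> nat) list \<Rightarrow> real^'n::{finite,linorder} \<Rightarrow> real^'n::{finite,linorder}" where
  "word_inverse [] y = y"
| "word_inverse (j # js) y = local_inverse j (word_inverse js y)"

abbreviation proper :: "('n \<times> nat) list \<Rightarrow> bool" where
  "proper js \<equiv> \<forall>j\<in>set js. 1 \<le> snd j"

lemma word_inverse_in_cube: "y \<in> open_cube \<Longrightarrow> proper js \<Longrightarrow> word_inverse js y \<in> open_cube"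
  by (induction js) (auto intro: local_inverse_in_cube)

lemma word_inverse_append: "word_inverse (us @ vs) y = word_inverse us (word_inverse vs y)"
  by (induction us) auto

lemma inv_branch_eq: "y \<in> open_cube \<Longrightarrow> proper js \<Longrightarrow> inv_branch brun brun_dom js y = word_inverse js y"
  by (induction js) (auto simp: inv_into_brun word_inverse_in_cube)

lemma brun_iterate_word_inverse:
  "y \<in> open_cube \<Longrightarrow> proper js \<Longrightarrow> (brun ^^ length js) (word_inverse js y) = y"
proof (induction js)
  case (Cons j js)
  then show ?case
    using brun_local_inverse[of "word_inverse js y" j] by (simp add: funpow_Suc_right word_inverse_in_cube del: funpow.simps)
qed simp

lemma cylinder_eq:
  "js \<noteq> [] \<Longrightarrow> proper (js :: ('n::{finite,linorder} \<times> nat) list)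
      \<Longrightarrow> cylinder unit_cube brun brun_dom js = word_inverse js ` open_cube"
proof (induction js)
  case (Cons j js)
  have sub: "brun x \<in> cylinder unit_cube brun brun_dom js \<longleftrightarrow> brun x \<in> word_inverse js ` open_cube"
    if "x \<in> brun_dom j" for x
  proof (cases "js = []")
    case True
    have "brun x \<in> open_cube" using bij_brun_dom(2)[of j] that Cons.prems by auto
    then show ?thesis using True open_cube_subset by auto
  qed (use Cons in auto)
  show ?case (is "?A = ?B")
  proof (intro equalityI subsetI)
    fix x assume "x \<in> ?A"
    then have x: "x \<in> brun_dom j" "brun x \<in> word_inverse js ` open_cube" using sub by auto
    then obtain y where y: "y \<in> open_cube" "brun x = word_inverse js y" by auto
    then have "x = word_inverse (j # js) y"
      using x(1) Cons.prems local_inverse_branch_map[of x j] brun_on_dom[of x j] by simp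
    then show "x \<in> ?B" using y by blast
  next
    fix x assume "x \<in> ?B"
    then obtain y where y: "y \<in> open_cube" "x = local_inverse j (word_inverse js y)" by auto
    have c: "word_inverse js y \<in> open_cube" using y Cons.prems by (simp add: word_inverse_in_cube)
    then have "x \<in> brun_dom j" "brun x = word_inverse js y"
      using y Cons.prems by (simp_all add: local_inverse_in_dom brun_local_inverse)
    moreover have "brun x \<in> word_inverse js ` open_cube" using calculation(2) y(1) by blast
    ultimately show "x \<in> ?A" using sub[of x] by simp
  qed
qed simp

lemma branch_dom_eq:
  assumes "js \<noteq> []" "proper (js :: ('n::{finite,linorder} \<times> nat) list)"
  shows "branch_dom unit_cube brun brun_dom js = open_cube"
  unfolding branch_dom_def cylinder_eq[OF assms]
  using brun_iterate_word_inverse[OF _ assms(2)] by (force simp: image_iff)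

lemma admissible_words_eq:
  "admissible_words unit_cube brun brun_branches (brun_dom :: 'n \<times> nat
      \<Rightarrow> (real^'n::{finite,linorder}) set) = {js. js \<noteq> [] \<and> proper js}"
proof -
  have "(\<chi> l. (1/2 :: real)) \<in> (open_cube :: (real^'n::{finite,linorder}) set)" by (auto simp: open_cube_def)
  moreover have "set js \<subseteq> brun_branches \<longleftrightarrow> proper js" for js :: "('n \<times> nat) list"
    unfolding brun_branches_def by fastforce
  ultimately show ?thesis unfolding admissible_words_def by (auto simp: cylinder_eq)
qed

section \<open>Homogeneous coordinates and the pairing of rows with points\<close>

definition hom_coord :: "real^'n \<Rightarrow> 'n option \<Rightarrow> real" where
  "hom_coord y b = (case b of None \<Rightarrow> 1 | Some p \<Rightarrow> y $ p)"

lemma hom_coord_simps [simp]: "hom_coord y None = 1" "hom_coord y (Some p) = y $ p"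
  by (simp_all add: hom_coord_def)

lemma hom_coord_bounds: "y \<in> open_cube \<Longrightarrow> 0 < hom_coord y b \<and> hom_coord y b \<le> 1"
  by (cases b) (auto simp: open_cube_def intro: less_imp_le)

text \<open>
  The relabelling of the homogeneous coordinates, in which \<open>None\<close> stands for the coordinate \<open>0\<close>: it is \<open>turn i\<close>
  followed by the exchange of \<open>0\<close> and \<open>i\<close>.
\<close>

definition hom_turn :: "'n \<Rightarrow> 'n option \<Rightarrow> 'n::{finite,linorder} option" where
  "hom_turn i b = (case b of None \<Rightarrow> Some i | Some p \<Rightarrow> if p = slot i then None else Some (turn i p))"

lemma bij_hom_turn: "bij (hom_turn i)"
proof -
  have "turn i p \<noteq> i" if "p \<noteq> slot i" for p using that by (simp add: turn_eq_iff)
  then have "inj (hom_turn i)"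
    using permutes_inj[OF turn_permutes, of i]
    by (auto simp: hom_turn_def inj_def split: option.splits)
  then show ?thesis by (simp add: bij_def finite_UNIV_inj_surj)
qed

text \<open>
  The map \<open>c\<close> sends current labels to positions that are never relabelled. The largest coordinate
  has label \<open>None\<close>; after the branch \<open>(i, k)\<close> it sits at the position \<open>c (Some i)\<close>.
\<close>

primrec word_path :: "('n option \<Rightarrow> 'n option) \<Rightarrow> ('n::{finite,linorder} \<times> nat) list
    \<Rightarrow> ('n option \<times> nat) list" where
  "word_path c [] = []"
| "word_path c (j # js) = (c (Some (fst j)), snd j) # word_path (\<lambda>b. c (hom_turn (fst j) b)) js"

primrec word_end :: "('n option \<Rightarrow> 'n option) \<Rightarrow> ('n::{finite,linorder} \<times> nat) list \<Rightarrow> 'n option \<Rightarrow> 'n option" where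
  "word_end c [] = c"
| "word_end c (j # js) = word_end (\<lambda>b. c (hom_turn (fst j) b)) js"

text \<open>
  The coordinate \<open>0\<close> of the homogeneous vector obtained from \<open>(1, y)\<close> by the product of matrices that
  belongs to the word: each step contributes the denominator by which its result is normalised.
\<close>

primrec word_denom :: "('n \<times> nat) list \<Rightarrow> real^'n::{finite,linorder} \<Rightarrow> real" where
  "word_denom [] y = 1"
| "word_denom (j # js) y = denom j (word_inverse js y) * word_denom js y"

lemma hom_turn_None [simp]: "hom_turn i None = Some i" by (simp add: hom_turn_def)

lemma length_word_path [simp]: "length (word_path c js) = length js"
  by (induction js arbitrary: c) auto

lemma final_pos_word_path: "final_pos (c None) (word_path c js) = word_end c js None"
proof (induction js arbitrary: c)
  case (Cons j js)
  show ?case using Cons[of "\<lambda>b. c (hom_turn (fst j) b)"] by simp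
qed simp

lemma alternating_word_path: "inj c \<Longrightarrow> proper js \<Longrightarrow> alternating (c None) (word_path c js)"
proof (induction js arbitrary: c)
  case (Cons j js)
  have "inj (\<lambda>b. c (hom_turn (fst j) b))" using inj_compose[OF Cons.prems(1) bij_is_inj[OF bij_hom_turn]] by (simp add: comp_def)
  then show ?case using Cons.IH[of "\<lambda>b. c (hom_turn (fst j) b)"] Cons.prems by (auto dest: injD)
qed simp

lemma word_denom_pos: "y \<in> open_cube \<Longrightarrow> proper js \<Longrightarrow> 0 < word_denom js y"
proof (induction js)
  case (Cons j js)
  then show ?case using denom_pos[of "word_inverse js y" j] word_inverse_in_cube[of y js] by simp
qed simp

text \<open>
  One factor of the duality: \<open>local_inverse j\<close> multiplies the homogeneous vector of \<open>y\<close> by an elementary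
  matrix and divides by \<open>denom j y\<close>; the matrix may be moved to the linear form.
\<close>

lemma local_inverse_pairing:
  assumes "y \<in> open_cube" "1 \<le> snd j" "bij c"
  shows "denom j y * (\<Sum>b\<in>UNIV. f (c b) * hom_coord (local_inverse j y) b)
       = (\<Sum>b\<in>UNIV. grow (c None) (c (Some (fst j)), snd j) f (c (hom_turn (fst j) b)) * hom_coord y b)"
proof -
  let ?i = "fst j" and ?k = "real (snd j)"
  have D: "denom j y \<noteq> 0" using denom_pos[OF assms(1,2)] by simp
  have hom: "denom j y * hom_coord (local_inverse j y) (hom_turn ?i a) = hom_coord y a + (if a = Some (slot ?i) then ?k else 0)" for a
    using D by (auto simp: hom_turn_def local_inverse_def turn_eq_iff split: option.splits)
  have injc: "c x = c z \<longleftrightarrow> x = z" for x z using assms(3) by (auto dest: bij_is_inj injD)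
  have hom_turnN: "hom_turn ?i a = Some ?i \<longleftrightarrow> a = None" for a
    using bij_hom_turn[of ?i] by (metis bij_is_inj injD hom_turn_None)
  have grow: "grow (c None) (c (Some ?i), snd j) f (c (hom_turn ?i a)) = f (c (hom_turn ?i a)) + (if a
      = None then ?k * f (c None) else 0)" for a
    by (auto simp: injc hom_turnN)
  have "(\<Sum>b\<in>UNIV. f (c b) * hom_coord (local_inverse j y) b)
      = (\<Sum>a\<in>UNIV. f (c (hom_turn ?i a)) * hom_coord (local_inverse j y) (hom_turn ?i a))"
    using bij_hom_turn[of ?i] by (simp add: sum.reindex_bij_betw[where g = "\<lambda>b. f (c b) * hom_coord (local_inverse j y) b"])
  then have "denom j y * (\<Sum>b\<in>UNIV. f (c b) * hom_coord (local_inverse j y) b)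
      = (\<Sum>a\<in>UNIV. f (c (hom_turn ?i a)) * (denom j y * hom_coord (local_inverse j y) (hom_turn ?i a)))"
    by (simp add: sum_distrib_left mult_ac)
  also have "\<dots> = (\<Sum>a\<in>UNIV. f (c (hom_turn ?i a)) * hom_coord y a + (if a = Some (slot ?i) then ?k * f (c None) else 0))"
    unfolding hom by (intro sum.cong) (auto simp: distrib_left hom_turn_def)
  also have "\<dots> = (\<Sum>a\<in>UNIV. f (c (hom_turn ?i a)) * hom_coord y a) + ?k * f (c None)"
    by (simp add: sum.distrib)
  also have "\<dots> = (\<Sum>a\<in>UNIV. f (c (hom_turn ?i a)) * hom_coord y a + (if a = None then ?k * f (c None) else 0))"
    by (simp add: sum.distrib)
  also have "\<dots> = (\<Sum>a\<in>UNIV. grow (c None) (c (Some ?i), snd j) f (c (hom_turn ?i a)) * hom_coord y a)"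
    unfolding grow by (intro sum.cong) (auto simp: distrib_right)
  finally show ?thesis .
qed

lemma word_inverse_pairing:
  assumes "y \<in> open_cube" "proper js" "bij c"
  shows "word_denom js y * (\<Sum>b\<in>UNIV. f (c b) * hom_coord (word_inverse js y) b)
       = (\<Sum>b\<in>UNIV. row_run (c None) (word_path c js) f (word_end c js b) * hom_coord y b)"
  using assms
proof (induction js arbitrary: c f)
  case (Cons j js)
  let ?f = "grow (c None) (c (Some (fst j)), snd j) f"
  have "word_denom (j # js) y * (\<Sum>b\<in>UNIV. f (c b) * hom_coord (word_inverse (j # js) y) b)
      = word_denom js y * (denom j (word_inverse js y) * (\<Sum>b\<in>UNIV. f (c b) * hom_coord (local_inverse j (word_inverse js y)) b))"
    by simp
  also have "\<dots> = word_denom js y * (\<Sum>b\<in>UNIV. ?f ((\<lambda>b. c (hom_turn (fst j) b)) b) * hom_coord (word_inverse js y) b)"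
    using local_inverse_pairing[of "word_inverse js y" j c f] Cons.prems word_inverse_in_cube[of y js] by simp
  also have "\<dots> = (\<Sum>b\<in>UNIV. row_run ((\<lambda>b. c (hom_turn (fst j) b)) None) (word_path (\<lambda>b. c (hom_turn (fst j) b)) js) ?f (word_end (\<lambda>b. c (hom_turn (fst j) b)) js b) * hom_coord y b)"
    using Cons.prems bij_comp[OF bij_hom_turn Cons.prems(3)] by (intro Cons.IH) (auto simp: comp_def)
  finally show ?case by (simp del: fun_upd_apply)
qed simp

text \<open>
  The cross difference is the sum of the minors against \<open>Z p * (Z' q - Z q)\<close>, since by antisymmetry the
  minors annihilate \<open>Z p * Z q\<close>.
\<close>

lemma quotient_minor_bound:
  fixes w g Z Z' :: "'b::finite \<Rightarrow> real"
  assumes minor: "\<And>p q. \<bar>g p * w q - g q * w p\<bar> \<le> m" and Z: "\<And>p. 0 \<le> Z p \<and> Z p \<le> 1"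
    and t: "\<And>p. \<bar>Z' p - Z p\<bar> \<le> t"
  shows "\<bar>(\<Sum>p\<in>UNIV. g p * Z p) * (\<Sum>p\<in>UNIV. w p * Z' p) - (\<Sum>p\<in>UNIV. g p * Z' p) * (\<Sum>p\<in>UNIV. w p * Z p)\<bar>
       \<le> real CARD('b) ^ 2 * m * t"
proof -
  define E where "E p = Z' p - Z p" for p
  have Z': "Z' p = Z p + E p" for p by (simp add: E_def)
  have m0: "0 \<le> m" using minor[of undefined undefined] by simp
  have "(\<Sum>p\<in>UNIV. g p * Z p) * (\<Sum>p\<in>UNIV. w p * Z' p) - (\<Sum>p\<in>UNIV. g p * Z' p) * (\<Sum>p\<in>UNIV. w p * Z p)
      = (\<Sum>p\<in>UNIV. g p * Z p) * (\<Sum>q\<in>UNIV. w q * E q) - (\<Sum>p\<in>UNIV. w p * Z p) * (\<Sum>q\<in>UNIV. g q * E q)"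
    by (simp add: Z' distrib_left sum.distrib algebra_simps)
  also have "\<dots> = (\<Sum>p\<in>UNIV. \<Sum>q\<in>UNIV. (g p * w q - g q * w p) * (Z p * E q))"
    unfolding sum_product sum_subtractf[symmetric] by (intro sum.cong) (auto simp: algebra_simps)
  finally have eq: "(\<Sum>p\<in>UNIV. g p * Z p) * (\<Sum>p\<in>UNIV. w p * Z' p) - (\<Sum>p\<in>UNIV. g p * Z' p) * (\<Sum>p\<in>UNIV. w p * Z p)
      = (\<Sum>p\<in>UNIV. \<Sum>q\<in>UNIV. (g p * w q - g q * w p) * (Z p * E q))" .
  have "\<bar>(g p * w q - g q * w p) * (Z p * E q)\<bar> \<le> m * (1 * t)" for p q
    unfolding abs_mult using minor Z[of p] t[of q] m0 by (intro mult_mono) (auto simp: E_def)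
  then have "\<bar>\<Sum>p\<in>UNIV. \<Sum>q\<in>UNIV. (g p * w q - g q * w p) * (Z p * E q)\<bar> \<le> (\<Sum>p\<in>(UNIV :: 'b set). \<Sum>q\<in>(UNIV :: 'b set). m * t)"
    by (intro order_trans[OF sum_abs] sum_mono) simp
  then show ?thesis unfolding eq by (simp add: power2_eq_square mult_ac)
qed

section \<open>Uniform contraction\<close>

text \<open>
  With \<open>c = id\<close> the word starts at position \<open>None\<close>. The initial unit vector at \<open>l\<close> yields row \<open>l\<close> of the matrix
  of the word, the constant \<open>1\<close> the sum of all rows. The sum is used as the weight because, unlike
  a single row, it is positive everywhere from the beginning.
\<close>

definition total_row :: "('n::{finite,linorder} \<times> nat) list \<Rightarrow> 'n option \<Rightarrow> real" where
  "total_row js = row_run None (word_path id js) (\<lambda>_. 1)"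

definition coord_row :: "'n option \<Rightarrow> ('n::{finite,linorder} \<times> nat) list \<Rightarrow> 'n option \<Rightarrow> real" where
  "coord_row l js = row_run None (word_path id js) (\<lambda>b. if b = l then 1 else 0)"

lemma rows_weights:
  assumes "proper js"
  shows "weights_on UNIV (word_end id js None) (total_row js) (coord_row l js)"
  using weights_on_run[of UNIV None "\<lambda>_. 1" "\<lambda>b. if b = l then 1 else 0" "word_path id js"]
    alternating_word_path[of id js] assms final_pos_word_path[of id js]
  by (auto simp: total_row_def coord_row_def weights_on_def)

lemma coord_row_pairing:
  assumes "y \<in> open_cube" "proper js"
  shows "word_denom js y * hom_coord (word_inverse js y) l = (\<Sum>b\<in>UNIV. coord_row l js (word_end id js b) * hom_coord y b)"
    and "word_denom js y * (\<Sum>b\<in>UNIV. hom_coord (word_inverse js y) b) = (\<Sum>b\<in>UNIV. total_row js (word_end id js b) * hom_coord y b)"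
proof -
  have "(\<Sum>b\<in>UNIV. (if b = l then 1 else 0) * hom_coord (word_inverse js y) b) = hom_coord (word_inverse js y) l"
    by (subst sum.mono_neutral_cong_right[where S = "{l}"]) auto
  then show "word_denom js y * hom_coord (word_inverse js y) l = (\<Sum>b\<in>UNIV. coord_row l js (word_end id js b) * hom_coord y b)"
    using word_inverse_pairing[OF assms bij_id, of "\<lambda>b. if b = l then 1 else 0"] by (simp add: coord_row_def)
  show "word_denom js y * (\<Sum>b\<in>UNIV. hom_coord (word_inverse js y) b) = (\<Sum>b\<in>UNIV. total_row js (word_end id js b) * hom_coord y b)"
    using word_inverse_pairing[OF assms bij_id, of "\<lambda>_. 1"] by (simp add: total_row_def)
qed

lemma hom_coord_diff: "\<bar>hom_coord y b - hom_coord z b\<bar> \<le> norm (y - z)"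
  by (cases b) (auto simp: component_le_norm_cart simp flip: vector_minus_component)

text \<open>
  With \<open>S\<close> the sum of the homogeneous coordinates, \<open>X\<^sub>l / S\<close> is the quotient of the row \<open>l\<close> and the total
  row, paired with \<open>y\<close>; clustering bounds the minors of these two rows. Passing from \<open>X\<^sub>l / S\<close> to
  \<open>x\<^sub>l = X\<^sub>l / X\<^sub>0\<close> costs a factor because \<open>S \<le> m + 1\<close> when \<open>X\<^sub>0 = 1\<close>.
\<close>

lemma word_inverse_lipschitz_clustered:
  fixes js :: "('n::{finite,linorder} \<times> nat) list"
  assumes y: "y \<in> open_cube" "y' \<in> open_cube" and js: "proper js" and d: "0 \<le> d"
    and cl: "\<And>l. clustered d UNIV (word_end id js None) (total_row js) (coord_row l js)"
  shows "norm (word_inverse js y - word_inverse js y') \<le> 2 * real (CARD('n) + 1) ^ 4 * d * norm (y - y')"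
proof -
  define N where "N = real (CARD('n) + 1)"
  have cardN: "real CARD('n option) = N" by (simp add: N_def card_UNIV_option)
  define t where "t = norm (y - y')"
  define e where "e = word_end id js"
  define w where "w b = total_row js (e b)" for b
  define g where "g l b = coord_row l js (e b)" for l b
  define x where "x = word_inverse js y"
  define x' where "x' = word_inverse js y'"
  define S where "S v = (\<Sum>b\<in>(UNIV :: 'n option set). hom_coord v b)" for v :: "real^'n::{finite,linorder}"
  define pw where "pw f v = (\<Sum>b\<in>(UNIV :: 'n option set). f b * hom_coord v b)" for f and v :: "real^'n::{finite,linorder}"
  have xs: "x \<in> open_cube" "x' \<in> open_cube" using y js by (auto simp: x_def x'_def word_inverse_in_cube)
  have W: "weights_on UNIV (e None) (total_row js) (coord_row l js)" for l
    unfolding e_def by (rule rows_weights[OF js])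
  have w: "0 < w b" "w b \<le> w None" for b using W unfolding weights_on_def w_def by auto
  have minor: "\<bar>g l p * w q - g l q * w p\<bar> \<le> d * (w None)\<^sup>2" for l p q
    unfolding g_def w_def using cl W d by (intro clustered_minor_le[where R = UNIV]) (auto simp: e_def)
  have S: "0 < S v" "S v \<le> N" if "v \<in> open_cube" for v
  proof -
    show "0 < S v" unfolding S_def using hom_coord_bounds[OF that] by (intro sum_pos) auto
    have "S v \<le> of_nat (card (UNIV :: 'n option set)) * 1"
      unfolding S_def using hom_coord_bounds[OF that] by (intro sum_bounded_above) auto
    then show "S v \<le> N" by (simp add: N_def)
  qed
  have pw: "w None \<le> pw w v" if "v \<in> open_cube" for v
  proof -
    have "w None * hom_coord v None \<le> pw w v" unfolding pw_def
      using w hom_coord_bounds[OF that] by (intro member_le_sum) (auto intro!: mult_nonneg_nonneg intro: less_imp_le)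
    then show ?thesis by simp
  qed
  have quot: "hom_coord (word_inverse js v) l / S (word_inverse js v) = pw (g l) v / pw w v" if "v \<in> open_cube" for v l
  proof -
    have "pw (g l) v = word_denom js v * hom_coord (word_inverse js v) l" "pw w v = word_denom js v * S (word_inverse js v)"
      using coord_row_pairing[OF that js] unfolding pw_def g_def w_def S_def e_def by auto
    then show ?thesis using word_denom_pos[OF that js] by simp
  qed
  have close: "\<bar>hom_coord x l / S x - hom_coord x' l / S x'\<bar> \<le> N\<^sup>2 * d * t" for l
  proof -
    have pos: "0 < pw w y" "0 < pw w y'" using pw[OF y(1)] pw[OF y(2)] w[of None] by linarith+
    have "\<bar>pw (g l) y * pw w y' - pw (g l) y' * pw w y\<bar> \<le> N\<^sup>2 * (d * (w None)\<^sup>2) * t"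
      unfolding pw_def cardN[symmetric]
      using minor hom_coord_bounds[OF y(1)] hom_coord_diff[of y' _ y]
      by (intro quotient_minor_bound) (auto simp: t_def norm_minus_commute intro: less_imp_le)
    also have "\<dots> = N\<^sup>2 * d * t * (w None * w None)" by (simp add: power2_eq_square mult_ac)
    also have "\<dots> \<le> N\<^sup>2 * d * t * (pw w y * pw w y')"
      using pw[OF y(1)] pw[OF y(2)] w[of None] d by (intro mult_left_mono mult_mono) (auto simp: t_def N_def)
    finally have "\<bar>pw (g l) y * pw w y' - pw (g l) y' * pw w y\<bar> / (pw w y * pw w y') \<le> N\<^sup>2 * d * t"
      using pos by (simp add: pos_divide_le_eq)
    moreover have "hom_coord x l / S x - hom_coord x' l / S x' = (pw (g l) y * pw w y' - pw (g l) y' * pw w y) / (pw w y * pw w y')"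
      unfolding x_def x'_def quot[OF y(1)] quot[OF y(2)] using pos by (simp add: field_simps)
    ultimately show ?thesis using pos by (simp add: abs_mult)
  qed
  have comp: "\<bar>x $ l - x' $ l\<bar> \<le> 2 * N ^ 3 * d * t" for l
  proof -
    have S0: "0 < S x" "S x \<le> N" "0 < S x'" using S xs by auto
    have xl: "0 < x' $ l" "x' $ l < 1" using xs by (auto simp: open_cube_def)
    have "x $ l - x' $ l = S x * (x $ l / S x - x' $ l / S x') + (x' $ l * S x) * (1 / S x' - 1 / S x)"
      using S0 by (simp add: field_simps)
    also have "\<bar>\<dots>\<bar> \<le> S x * \<bar>x $ l / S x - x' $ l / S x'\<bar> + (x' $ l * S x) * \<bar>1 / S x' - 1 / S x\<bar>"
      using S0 xl by (intro order_trans[OF abs_triangle_ineq]) (simp add: abs_mult)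
    also have "\<dots> \<le> N * (N\<^sup>2 * d * t) + (1 * N) * (N\<^sup>2 * d * t)"
      using S0 xl close[of "Some l"] close[of None] by (intro add_mono mult_mono) (auto simp: abs_minus_commute N_def)
    also have "\<dots> = 2 * N ^ 3 * d * t" by (simp add: power2_eq_square power3_eq_cube)
    finally show ?thesis .
  qed
  have "norm (x - x') \<le> (\<Sum>l\<in>UNIV. \<bar>(x - x') $ l\<bar>)" by (rule norm_le_l1_cart)
  also have "\<dots> \<le> of_nat (card (UNIV :: 'n set)) * (2 * N ^ 3 * d * t)"
    using comp by (intro sum_bounded_above) auto
  also have "\<dots> \<le> N * (2 * N ^ 3 * d * t)"
    using d by (intro mult_right_mono) (auto simp: N_def t_def)
  finally show ?thesis by (simp add: x_def x'_def t_def N_def power_Suc numeral_eq_Suc mult_ac)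
qed

text \<open>
  Ratios in \<open>[0, 1]\<close> are clustered with constant \<open>1\<close>, which yields a Lipschitz constant common to all words.
\<close>

lemma word_inverse_bounded:
  fixes js :: "('n::{finite,linorder} \<times> nat) list"
  assumes "y \<in> open_cube" "y' \<in> open_cube" "proper js"
  shows "norm (word_inverse js y - word_inverse js y') \<le> 2 * real (CARD('n) + 1) ^ 4 * norm (y - y')"
proof -
  have "clustered 1 UNIV (word_end id js None) (total_row js) (coord_row l js)" for l
    using rows_weights[OF assms(3), of l] unfolding clustered_def weights_on_def by (simp add: leD)
  then show ?thesis using word_inverse_lipschitz_clustered[of y y' js 1] assms by simp
qed

lemma word_inverse_eventually_contracting:
  assumes "0 < e"
  shows "\<exists>L. \<forall>js y y'. proper (js :: ('n::{finite,linorder} \<times> nat) list) \<longrightarrow> L \<le> length js \<longrightarrow> y \<in> open_cube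
      \<longrightarrow> y' \<in> open_cube \<longrightarrow>
    norm (word_inverse js y - word_inverse js y') \<le> e * norm (y - y')"
proof -
  define C where "C = 2 * real (CARD('n) + 1) ^ 4"
  have C: "0 < C" by (simp add: C_def)
  from uniformly_clustered[OF divide_pos_pos[OF assms C], of "CARD('n option)"]
  obtain L where L: "\<forall>R s ps w g. finite R \<longrightarrow> card R \<le> CARD('n option) \<longrightarrow> weights_on (R :: 'n option set) s w g \<longrightarrow>
      alternating s ps \<longrightarrow> fst ` set ps \<subseteq> R \<longrightarrow> L \<le> length ps \<longrightarrow>
      clustered (e / C) R (final_pos s ps) (row_run s ps w) (row_run s ps g)" ..
  have "norm (word_inverse js y - word_inverse js y') \<le> e * norm (y - y')"
    if "proper js" "L \<le> length js" "y \<in> open_cube" "y' \<in> open_cube" for js :: "('n \<times> nat) list" and y y'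
  proof -
    have "clustered (e / C) UNIV (word_end id js None) (total_row js) (coord_row l js)" for l
      using L[rule_format, of UNIV None "\<lambda>_. 1" "\<lambda>b. if b = l then 1 else 0" "word_path id js"] that
        alternating_word_path[of id js] final_pos_word_path[of id js]
      by (auto simp: total_row_def coord_row_def weights_on_def)
    then have "norm (word_inverse js y - word_inverse js y') \<le> 2 * real (CARD('n) + 1) ^ 4 * (e / C) * norm (y - y')"
      using that assms C by (intro word_inverse_lipschitz_clustered) auto
    also have "2 * real (CARD('n) + 1) ^ 4 * (e / C) = e" using C unfolding C_def by simp
    finally show ?thesis .
  qed
  then show ?thesis by blast
qed

text \<open>
  Since Lipschitz constants are submultiplicative, a length \<open>L\<close> at which all words contract by \<open>1 / 2\<close>
  gives the rate \<open>\<rho>\<close> with \<open>\<rho> ^ L = 1 / 2\<close>; a remainder shorter than \<open>L\<close> costs the constant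
  of \<open>word_inverse_bounded\<close> and a factor of at most \<open>2\<close>.
\<close>

lemma word_inverse_exponential:
  "\<exists>C \<rho>. 0 < C \<and> 0 < \<rho> \<and> \<rho> < 1 \<and> (\<forall>js y y'. proper (js :: ('n::{finite,linorder} \<times> nat) list)
      \<longrightarrow> y \<in> open_cube \<longrightarrow> y' \<in> open_cube \<longrightarrow>
    norm (word_inverse js y - word_inverse js y') \<le> C * \<rho> ^ length js * norm (y - y'))"
proof -
  define B where "B = 2 * real (CARD('n) + 1) ^ 4"
  obtain L0 where L0: "\<And>js y y'. proper (js :: ('n \<times> nat) list) \<Longrightarrow> L0 \<le> length js \<Longrightarrow> y \<in> open_cube
      \<Longrightarrow> y' \<in> open_cube \<Longrightarrow>
    norm (word_inverse js y - word_inverse js y') \<le> (1/2) * norm (y - y')"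
    using word_inverse_eventually_contracting[of "1/2", where 'n = 'n] half_gt_zero[OF zero_less_one] by blast
  define L where "L = Suc L0"
  define \<rho> where "\<rho> = root L (1/2)"
  have L: "0 < L" by (simp add: L_def)
  have \<rho>: "0 < \<rho>" "\<rho> < 1" "\<rho> ^ L = 1/2"
    unfolding \<rho>_def using L by (simp_all add: real_root_pow_pos2)
  have "norm (word_inverse js y - word_inverse js y') \<le> 2 * B * \<rho> ^ length js * norm (y - y')"
    if "proper js" "y \<in> open_cube" "y' \<in> open_cube" for js :: "('n \<times> nat) list" and y y'
    using that
  proof (induction "length js" arbitrary: js rule: less_induct)
    case less
    show ?case
    proof (cases "L \<le> length js")
      case True
      define us where "us = take L js"
      define vs where "vs = drop L js"
      have js: "js = us @ vs" "length us = L" "length vs < length js"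
        using True by (auto simp: us_def vs_def L_def)
      have p: "proper us" "proper vs" using less.prems(1) unfolding js(1) by auto
      have "norm (word_inverse js y - word_inverse js y') \<le> (1/2) * norm (word_inverse vs y - word_inverse vs y')"
        unfolding js(1) word_inverse_append
        using p js(2) less.prems by (intro L0 word_inverse_in_cube) (auto simp: L_def)
      also have "\<dots> \<le> (1/2) * (2 * B * \<rho> ^ length vs * norm (y - y'))"
        using less p js(3) by (intro mult_left_mono less.hyps) auto
      also have "\<dots> = 2 * B * \<rho> ^ length js * norm (y - y')"
        unfolding js(1) by (simp add: js(2) power_add \<rho>(3))
      finally show ?thesis .
    next
      case False
      have "\<rho> ^ L \<le> \<rho> ^ length js" using False \<rho> by (intro power_decreasing) auto
      then have "B \<le> 2 * B * \<rho> ^ length js"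
        using \<rho>(3) mult_left_mono[of "1/2" "\<rho> ^ length js" "2 * B"] by (simp add: B_def)
      then have "B * norm (y - y') \<le> 2 * B * \<rho> ^ length js * norm (y - y')"
        by (intro mult_right_mono) auto
      then show ?thesis
        using word_inverse_bounded[OF less.prems(2,3,1), folded B_def] by (rule order_trans[rotated])
    qed
  qed
  moreover have "0 < 2 * B" by (simp add: B_def)
  ultimately show ?thesis using \<rho>(1,2) by blast
qed

text \<open>
  A single row may vanish somewhere, but if it is largest at the current position, it remains so. This
  holds for row \<open>None\<close>, which starts as the unit vector at the initial position.
\<close>

lemma row_max_at_position:
  assumes "\<And>p. 0 \<le> f p \<and> f p \<le> f s" "alternating s ps"
  shows "row_run s ps f p \<le> row_run s ps f (final_pos s ps)"
  using assms
proof (induction ps arbitrary: s f)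
  case (Cons a ps)
  have f: "0 \<le> f p" "f p \<le> f s" for p using Cons.prems(1) by auto
  have "f s \<le> real (snd a) * f s"
    using f Cons.prems(2) mult_right_mono[of 1 "real (snd a)" "f s"] by simp
  then have *: "f q \<le> f (fst a) + real (snd a) * f s" for q using f[of q] f[of "fst a"] by linarith
  have "0 \<le> grow s a f q \<and> grow s a f q \<le> grow s a f (fst a)" for q
    using f *[of q] f(1)[of s] by (auto intro!: add_nonneg_nonneg mult_nonneg_nonneg)
  then have "row_run (fst a) ps (grow s a f) p \<le> row_run (fst a) ps (grow s a f) (final_pos (fst a) ps)"
    using Cons.prems(2) by (intro Cons.IH) auto
  then show ?case by simp
qed simp

lemma coord_row_None_le:
  assumes "proper js"
  shows "coord_row None js p \<le> coord_row None js (word_end id js None)"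
  using row_max_at_position[of "\<lambda>b. if b = None then 1 else 0" None "word_path id js" p]
    alternating_word_path[of id js] final_pos_word_path[of id js] assms
  by (auto simp: coord_row_def)

section \<open>Jacobians and bounded distortion\<close>

definition local_inverse_deriv :: "'n \<times> nat \<Rightarrow> real^'n::{finite,linorder} \<Rightarrow> real^'n::{finite,linorder}
    \<Rightarrow> real^'n::{finite,linorder}" where
  "local_inverse_deriv j y v = (\<chi> l. (if l = fst j then 0 else v $ unturn (fst j) l) / denom j y
      - (if l = fst j then 1 else y $ unturn (fst j) l) * v $ slot (fst j) / (denom j y)\<^sup>2)"

lemma has_derivative_local_inverse:
  fixes y :: "real^'n::{finite,linorder}"
  assumes "denom j y \<noteq> 0"
  shows "(local_inverse j has_derivative local_inverse_deriv j y) (at y)"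
proof -
  let ?i = "fst j"
  define lin :: "real^'n::{finite,linorder}
      \<Rightarrow> real^'n::{finite,linorder}" where "lin v = (\<chi> l. if l = ?i then 0 else v $ unturn ?i l)" for v
  have "linear lin" by (rule linearI) (auto simp: lin_def vec_eq_iff)
  then have lin: "(lin has_derivative lin) (at y)"
    by (intro linear_imp_has_derivative)
  have eq: "local_inverse j = (\<lambda>v. inverse (denom j v) *\<^sub>R (axis ?i 1 + lin v))"
    by (auto simp: local_inverse_def lin_def vec_eq_iff axis_def divide_inverse mult.commute)
  have nth: "((\<lambda>v. v $ slot ?i) has_derivative (\<lambda>v. v $ slot ?i)) (at y)"
    by (rule bounded_linear_imp_has_derivative) (rule bounded_linear_vec_nth)
  have D: "((\<lambda>v. denom j v) has_derivative (\<lambda>v. v $ slot ?i)) (at y)"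
    using has_derivative_add[OF has_derivative_const nth, of "real (snd j)"] by simp
  have "((\<lambda>v. inverse (denom j v) *\<^sub>R (axis ?i 1 + lin v)) has_derivative
      (\<lambda>v. inverse (denom j y) *\<^sub>R lin v
          + (- (inverse (denom j y) * v $ slot ?i * inverse (denom j y))) *\<^sub>R (axis ?i 1 + lin y))) (at y)"
    using has_derivative_scaleR[OF Deriv.has_derivative_inverse[OF assms D] has_derivative_add[OF has_derivative_const lin]]
    by simp
  moreover have "(\<lambda>v. inverse (denom j y) *\<^sub>R lin v
      + (- (inverse (denom j y) * v $ slot ?i * inverse (denom j y))) *\<^sub>R (axis ?i 1 + lin y)) = local_inverse_deriv j y"
    by (auto simp: fun_eq_iff vec_eq_iff local_inverse_deriv_def lin_def axis_def divide_inverse power2_eq_square)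
  ultimately show ?thesis unfolding eq by simp
qed

text \<open>
  Row operations remove the entries of row \<open>q\<close> off the diagonal.
\<close>

lemma det_one_row_changed:
  fixes a :: "'n::finite \<Rightarrow> real" and d :: real
  assumes "d \<noteq> 0"
  shows "det (\<chi> r. if r = q then \<chi> p. a p else axis r d) = a q * d ^ (CARD('n) - 1)"
proof -
  define Del :: "real^'n^'n" where "Del = (\<chi> r. axis r (if r = q then a q else d))"
  define x where "x = (\<Sum>p\<in>UNIV - {q}. (a p / d) *s row p Del)"
  have "x \<in> vec.span {row p Del | p. p \<noteq> q}"
    unfolding x_def by (intro vec.span_sum vec.span_scale vec.span_base) auto
  then have "det (\<chi> k. if k = q then row q Del + x else row k Del) = det Del"
    by (rule det_row_span)
  moreover have "(\<chi> k. if k = q then row q Del + x else row k Del) = (\<chi> r. if r = q then \<chi> p. a p else axis r d)"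
  proof -
    have rowD: "row k Del = axis k (if k = q then a q else d)" for k
      by (simp add: row_def Del_def vec_eq_iff)
    have xc: "x $ p = (if p = q then 0 else a p)" for p
    proof -
      have "x $ p = (\<Sum>k\<in>UNIV - {q}. if k = p then a p else 0)"
        unfolding x_def rowD using assms
        by (simp only: sum_component vector_smult_component) (intro sum.cong, auto simp: axis_def)
      then show ?thesis by simp
    qed
    show ?thesis unfolding rowD by (auto simp: vec_eq_iff xc axis_def)
  qed
  moreover have "det Del = (\<Prod>r\<in>UNIV. Del $ r $ r)"
    by (rule det_diagonal) (auto simp: Del_def axis_def)
  moreover have "(\<Prod>r\<in>UNIV. Del $ r $ r) = (\<Prod>r\<in>UNIV. if r = q then a q else d)"
    by (simp add: Del_def axis_def)
  moreover have "\<dots> = a q * d ^ (CARD('n) - 1)"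
    by (subst prod.remove[of _ q]) (auto simp: card_Diff_singleton)
  ultimately show ?thesis by simp
qed

text \<open>
  Up to the permutation of the coordinates, the derivative is \<open>1 / denom\<close> times the identity,
  except for the column of \<open>slot (fst j)\<close>, whose diagonal entry is \<open>- 1 / denom\<^sup>2\<close>.
\<close>

lemma det_local_inverse_deriv:
  fixes y :: "real^'n::{finite,linorder}"
  assumes "denom j y \<noteq> 0"
  shows "det (matrix (local_inverse_deriv j y)) = - of_int (sign (unturn (fst j))) / denom j y ^ (CARD('n) + 1)"
proof -
  let ?q = "slot (fst j)" and ?D = "denom j y"
  define a where "a p = (if p = ?q then - 1 / ?D\<^sup>2 else - y $ p / ?D\<^sup>2)" for p
  define A :: "real^'n::{finite,linorder}^'n::{finite,linorder}" where "A = (\<chi> r. if r = ?q then \<chi> p. a p else axis r (1 / ?D))"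
  have "matrix (local_inverse_deriv j y) = (\<chi> l. transpose A $ unturn (fst j) l)"
    by (auto simp: vec_eq_iff matrix_def local_inverse_deriv_def transpose_def A_def a_def axis_def unturn_eq_iff)
  then have "det (matrix (local_inverse_deriv j y)) = of_int (sign (unturn (fst j))) * det (transpose A)"
    using det_permute_rows[OF unturn_permutes, where A = "transpose A"] by simp
  also have "det (transpose A) = a ?q * (1 / ?D) ^ (CARD('n) - 1)"
    unfolding det_transpose A_def using assms by (intro det_one_row_changed) simp
  also have "\<dots> = - 1 / ?D ^ (CARD('n) + 1)"
  proof -
    have "CARD('n) + 1 = 2 + (CARD('n) - 1)" using zero_less_card_finite[where 'a = 'n] by linarith
    then have "?D ^ (CARD('n) + 1) = ?D\<^sup>2 * ?D ^ (CARD('n) - 1)" by (metis power_add)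
    then show ?thesis by (simp add: a_def power_divide)
  qed
  finally show ?thesis by simp
qed

text \<open>
  The sign \<open>\<sigma>\<close> is chosen before the point: it depends only on the word, so that it cancels in the
  quotients of Jacobians at different points.
\<close>

lemma has_derivative_word_inverse:
  fixes js :: "('n::{finite,linorder} \<times> nat) list"
  assumes "proper js"
  shows "\<exists>\<sigma>::real. \<bar>\<sigma>\<bar> = 1 \<and> (\<forall>y\<in>open_cube. \<exists>H. (word_inverse js has_derivative H) (at y) \<and>
      det (matrix H) = \<sigma> / word_denom js y ^ (CARD('n) + 1))"
  using assms
proof (induction js)
  case Nil
  have "(word_inverse [] has_derivative (\<lambda>v. v)) (at y)" for y :: "real^'n::{finite,linorder}"
  proof -
    have "word_inverse [] = (\<lambda>v :: real^'n::{finite,linorder}. v)" by auto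
    then show ?thesis by simp
  qed
  then show ?case by (intro exI[of _ 1]) (auto intro!: exI[of _ "\<lambda>v. v"] simp: matrix_id_mat_1[unfolded id_def])
next
  case (Cons j js)
  let ?N = "CARD('n) + 1"
  obtain \<sigma> :: real where \<sigma>: "\<bar>\<sigma>\<bar> = 1" "\<And>y. y \<in> open_cube \<Longrightarrow> \<exists>H. (word_inverse js has_derivative H) (at y) \<and>
      det (matrix H) = \<sigma> / word_denom js y ^ ?N"
    using Cons by auto
  let ?s = "- of_int (sign (unturn (fst j))) * \<sigma>"
  have "\<exists>H. (word_inverse (j # js) has_derivative H) (at y) \<and> det (matrix H) = ?s / word_denom (j # js) y ^ ?N"
    if y: "y \<in> open_cube" for y
  proof -
    obtain H where H: "(word_inverse js has_derivative H) (at y)" "det (matrix H) = \<sigma> / word_denom js y ^ ?N"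
      using \<sigma>(2)[OF y] by blast
    let ?z = "word_inverse js y"
    have D: "denom j ?z \<noteq> 0" using denom_pos[OF word_inverse_in_cube[OF y], of js j] Cons.prems by simp
    note G = has_derivative_local_inverse[OF D]
    have "word_inverse (j # js) = local_inverse j \<circ> word_inverse js" by (auto simp: fun_eq_iff)
    then have "(word_inverse (j # js) has_derivative local_inverse_deriv j ?z \<circ> H) (at y)"
      using diff_chain_at[OF H(1) G] by simp
    moreover have "det (matrix (local_inverse_deriv j ?z \<circ> H)) = ?s / word_denom (j # js) y ^ ?N"
      using has_derivative_linear[OF H(1)] has_derivative_linear[OF G]
      by (simp add: matrix_compose det_mul det_local_inverse_deriv[OF D] H(2) power_mult_distrib del: power_Suc)
    ultimately show ?thesis by blast
  qed
  moreover have "\<bar>?s\<bar> = 1" using \<sigma>(1) by (simp add: abs_mult sign_def)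
  ultimately show ?case by blast
qed

lemma jacobian_inv_branch:
  fixes js :: "('n::{finite,linorder} \<times> nat) list"
  assumes "proper js"
  shows "\<exists>\<sigma>::real. \<bar>\<sigma>\<bar> = 1 \<and> (\<forall>y\<in>open_cube. inv_branch brun brun_dom js differentiable (at y) \<and>
      jacobian (inv_branch brun brun_dom js) y = \<sigma> / word_denom js y ^ (CARD('n) + 1))"
proof -
  obtain \<sigma> :: real where \<sigma>: "\<bar>\<sigma>\<bar> = 1" "\<And>y. y \<in> open_cube \<Longrightarrow> \<exists>H. (word_inverse js has_derivative H) (at y) \<and>
      det (matrix H) = \<sigma> / word_denom js y ^ (CARD('n) + 1)"
    using has_derivative_word_inverse[OF assms] by blast
  have "inv_branch brun brun_dom js differentiable (at y) \<and>
      jacobian (inv_branch brun brun_dom js) y = \<sigma> / word_denom js y ^ (CARD('n) + 1)" if y: "y \<in> open_cube" for y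
  proof -
    obtain H where H: "(word_inverse js has_derivative H) (at y)" "det (matrix H) = \<sigma> / word_denom js y ^ (CARD('n) + 1)"
      using \<sigma>(2)[OF y] by blast
    have H': "(inv_branch brun brun_dom js has_derivative H) (at y)"
      by (rule has_derivative_transform_within_open[OF H(1) open_open_cube y])
        (rule inv_branch_eq[symmetric, OF _ assms])
    show ?thesis unfolding jacobian_def frechet_derivative_at[OF H', symmetric] using H' H(2)
      by (auto simp: differentiable_def)
  qed
  then show ?thesis using \<sigma>(1) by blast
qed

text \<open>
  Let \<open>f\<close> be row \<open>None\<close>, read in the labels reached at the end of the word, so that \<open>word_denom js y\<close> is \<open>f\<close> paired with \<open>y\<close>. Both \<open>f b \<le> f None\<close> and
  \<open>f None \<le> word_denom js x\<close> hold, so the quotient \<open>r\<close> of two denominators lies in \<open>[0, m + 1]\<close> and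
  differs from \<open>1\<close> by at most \<open>(m + 1) * norm (x - y)\<close>; this carries over to its power.
\<close>

lemma bounded_distortion_brun:
  "bounded_distortion unit_cube brun brun_branches (brun_dom :: 'n \<times> nat \<Rightarrow> (real^'n::{finite,linorder}) set)"
proof -
  define N where "N = real (CARD('n) + 1)"
  define M where "M = N * N * N ^ (CARD('n) + 1)"
  have N: "1 \<le> N" by (simp add: N_def)
  have "\<bar>jacobian (inv_branch brun brun_dom js) x / jacobian (inv_branch brun brun_dom js) y - 1\<bar> \<le> M * norm (x - y)"
    if js: "proper js" and x: "x \<in> open_cube" and y: "y \<in> open_cube" for js :: "('n \<times> nat) list" and x y
  proof -
    obtain \<sigma> :: real where \<sigma>: "\<bar>\<sigma>\<bar> = 1" "\<And>y. y \<in> open_cube \<Longrightarrow>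
        jacobian (inv_branch brun brun_dom js) y = \<sigma> / word_denom js y ^ (CARD('n) + 1)"
      using jacobian_inv_branch[OF js] by blast
    define r where "r = word_denom js y / word_denom js x"
    have pos: "0 < word_denom js x" "0 < word_denom js y" using word_denom_pos js x y by auto
    have J: "jacobian (inv_branch brun brun_dom js) x / jacobian (inv_branch brun brun_dom js) y = r ^ (CARD('n) + 1)"
      unfolding \<sigma>(2)[OF x] \<sigma>(2)[OF y] r_def using pos \<sigma>(1) by (simp add: power_divide field_simps)
    define f where "f b = coord_row None js (word_end id js b)" for b
    have sc: "word_denom js z = (\<Sum>b\<in>UNIV. f b * hom_coord z b)" if "z \<in> open_cube" for z
      using coord_row_pairing(1)[OF that js, of None] by (simp add: f_def)
    have f: "0 \<le> f b" "f b \<le> f None" for b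
    proof -
      show "0 \<le> f b" using rows_weights[OF js, of None] by (simp add: f_def weights_on_def)
      show "f b \<le> f None" unfolding f_def by (rule coord_row_None_le[OF js])
    qed
    have low: "f None \<le> word_denom js x"
    proof -
      have "f None * hom_coord x None \<le> word_denom js x" unfolding sc[OF x]
        using f hom_coord_bounds[OF x] by (intro member_le_sum) (auto intro!: mult_nonneg_nonneg intro: less_imp_le)
      then show ?thesis by simp
    qed
    have "word_denom js y \<le> (\<Sum>b\<in>(UNIV :: 'n option set). f None * 1)" unfolding sc[OF y]
      using f hom_coord_bounds[OF y] by (intro sum_mono mult_mono) (auto intro: less_imp_le)
    then have up: "word_denom js y \<le> N * f None" by (simp add: N_def algebra_simps)
    have "\<bar>word_denom js y - word_denom js x\<bar> = \<bar>\<Sum>b\<in>UNIV. f b * (hom_coord y b - hom_coord x b)\<bar>"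
      unfolding sc[OF x] sc[OF y] by (simp add: sum_subtractf[symmetric] algebra_simps)
    also have "\<dots> \<le> (\<Sum>b\<in>(UNIV :: 'n option set). f None * norm (x - y))"
      using f hom_coord_diff[of y _ x]
      by (intro order_trans[OF sum_abs] sum_mono) (auto simp: abs_mult norm_minus_commute intro!: mult_mono)
    also have "\<dots> = f None * (N * norm (x - y))" by (simp add: N_def algebra_simps)
    also have "\<dots> \<le> word_denom js x * (N * norm (x - y))"
      using low N by (intro mult_right_mono) auto
    finally have "\<bar>word_denom js y - word_denom js x\<bar> / word_denom js x \<le> N * norm (x - y)"
      using pos by (simp add: pos_divide_le_eq mult.commute)
    moreover have "r - 1 = (word_denom js y - word_denom js x) / word_denom js x" using pos by (simp add: r_def field_simps)
    ultimately have r1: "\<bar>r - 1\<bar> \<le> N * norm (x - y)" using pos by simp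
    have "word_denom js y \<le> N * word_denom js x" using up low N by (meson mult_left_mono order_trans zero_le_one)
    then have r: "0 \<le> r" "r \<le> N" using pos by (auto simp: r_def pos_divide_le_eq)
    have "\<bar>r ^ (CARD('n) + 1) - 1\<bar> = \<bar>r - 1\<bar> * (\<Sum>i<CARD('n) + 1. r ^ i)"
      unfolding power_diff_1_eq abs_mult using r by (simp add: sum_nonneg del: sum.lessThan_Suc)
    also have "\<dots> \<le> (N * norm (x - y)) * (\<Sum>i<CARD('n) + 1. N ^ (CARD('n) + 1))"
    proof (intro mult_mono sum_mono r1)
      fix i assume "i \<in> {..<CARD('n) + 1}"
      then have "r ^ i \<le> N ^ i" "N ^ i \<le> N ^ (CARD('n) + 1)"
        using r N by (auto intro!: power_mono power_increasing simp del: power_Suc)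
      then show "r ^ i \<le> N ^ (CARD('n) + 1)" by linarith
    qed (use N r in \<open>auto intro!: sum_nonneg simp del: sum.lessThan_Suc\<close>)
    also have "\<dots> = M * norm (x - y)" by (simp add: M_def N_def)
    finally show ?thesis unfolding J .
  qed
  moreover have "0 < M" using N by (auto simp: M_def intro!: mult_pos_pos)
  moreover have "inv_branch brun brun_dom js differentiable (at x)"
    if "proper js" "x \<in> open_cube" for js :: "('n \<times> nat) list" and x
    using jacobian_inv_branch[OF that(1)] that(2) by blast
  ultimately show ?thesis unfolding bounded_distortion_def admissible_words_eq
    by (intro exI[of _ M]) (auto simp: branch_dom_eq)
qed

lemma uniformly_contracting_brun:
  "uniformly_contracting unit_cube brun brun_branches (brun_dom :: 'n \<times> nat \<Rightarrow> (real^'n::{finite,linorder}) set)"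
proof -
  obtain C \<rho> where "0 < C" "0 < \<rho>" "\<rho> < (1::real)"
    "\<forall>js y y'. proper (js :: ('n \<times> nat) list) \<longrightarrow> y \<in> open_cube \<longrightarrow> y' \<in> open_cube \<longrightarrow>
      norm (word_inverse js y - word_inverse js y') \<le> C * \<rho> ^ length js * norm (y - y')"
    using word_inverse_exponential[where 'n = 'n] by blast
  then show ?thesis unfolding uniformly_contracting_def admissible_words_eq
    by (intro exI[of _ C] exI[of _ \<rho>]) (auto simp: branch_dom_eq inv_branch_eq)
qed

section \<open>The Markov partition and the system of branches\<close>

lemma markov_partition_brun:
  "markov_partition unit_cube brun brun_branches (brun_dom :: 'n \<times> nat \<Rightarrow> (real^'n::{finite,linorder}) set)"
proof -
  have half: "(\<chi> l. (1/2 :: real)) \<in> (open_cube :: (real^'n::{finite,linorder}) set)" by (auto simp: open_cube_def)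
  have neg: "negligible (unit_cube - (open_cube :: (real^'n::{finite,linorder}) set))"
    unfolding open_cube_eq unit_cube_eq by (rule negligible_frontier_interval)
  have cube: "open_partition unit_cube {0::nat} (\<lambda>_. open_cube :: (real^'n::{finite,linorder}) set)"
    using half neg open_cube_subset by (auto simp: open_partition_def disjoint_family_on_def open_open_cube)
  have J: "1 \<le> snd j" if "j \<in> (brun_branches :: ('n \<times> nat) set)" for j using that by (auto simp: brun_branches_def)
  have img: "inv_into (brun_dom j) brun ` (open_cube \<inter> brun ` brun_dom j) \<subseteq> open_cube \<inter> brun_dom j"
    if "j \<in> brun_branches" for j :: "'n \<times> nat"
    using bij_brun_dom[OF J[OF that]] local_inverse_in_dom[OF _ J[OF that]] local_inverse_in_cube[OF _ J[OF that]]
    by (auto simp: inv_into_brun[OF _ J[OF that]])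
  show ?thesis unfolding markov_partition_def
  proof (rule exI[of _ "{0::nat}"], rule exI[of _ "\<lambda>_. open_cube"], intro conjI ballI)
    fix j :: "'n \<times> nat" assume j: "j \<in> brun_branches"
    show "\<exists>B\<subseteq>{0::nat}. closure (brun ` brun_dom j) = (\<Union>a\<in>B. closure open_cube)"
      using bij_brun_dom(2)[OF J[OF j]] by (intro exI[of _ "{0}"]) auto
    fix a :: nat assume "a \<in> {0}"
    show "brun_dom j \<inter> open_cube \<noteq> {} \<longrightarrow> brun_dom j \<subseteq> open_cube"
      using dom_subset_open_cube[OF J[OF j]] by simp
    show "(\<exists>!b. b \<in> {0::nat}
        \<and> inv_into (brun_dom j) brun ` (open_cube \<inter> brun ` brun_dom j) \<subseteq> open_cube \<inter> brun_dom j) \<or>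
       inv_into (brun_dom j) brun ` (open_cube \<inter> brun ` brun_dom j) \<inter> unit_cube = {}"
      using img[OF j] by auto
  qed (use cube closure_open_cube in auto)
qed

lemma open_brun_dom: "open (brun_dom j)"
proof -
  have "brun_dom j = (\<Inter>l. {x. 0 < x $ l}) \<inter> (\<Inter>l\<in>- {fst j}. {x. x $ l < x $ fst j})
      \<inter> {x. 1 / (real (snd j) + 1) < x $ fst j} \<inter> {x. x $ fst j < 1 / real (snd j)}"
    by (auto simp: brun_dom_iff)
  moreover have "open \<dots>"
    by (intro open_Int open_INT ballI open_Collect_less continuous_intros) auto
  ultimately show ?thesis by simp
qed

lemma brun_dom_disjoint:
  assumes "x \<in> brun_dom j" "x \<in> brun_dom j'" "1 \<le> snd j" "1 \<le> snd j'"
  shows "j = j'"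
proof -
  have f: "fst j = fst j'"
    using assms(1,2) by (metis brun_dom_iff less_asym)
  have x: "0 < x $ fst j" using assms(1) by (simp add: brun_dom_iff)
  have "real (snd j) < 1 / x $ fst j" "1 / x $ fst j < real (snd j) + 1"
    "real (snd j') < 1 / x $ fst j" "1 / x $ fst j < real (snd j') + 1"
    using assms x f by (auto simp: brun_dom_iff field_simps)
  then have "snd j = snd j'" by linarith
  with f show ?thesis by (simp add: prod_eq_iff)
qed

lemma brun_unit_cube: "x \<in> unit_cube \<Longrightarrow> brun x \<in> unit_cube"
proof -
  assume x: "x \<in> unit_cube"
  let ?i = "max_index x"
  have "0 \<le> x $ l" "x $ l \<le> x $ ?i" for l using x max_index_max by (auto simp: unit_cube_def)
  moreover have "x $ l / x $ ?i \<le> 1" for l using calculation by (intro divide_le_eq_1[THEN iffD2]) (smt (verit))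
  ultimately show ?thesis unfolding brun_eq Let_def unit_cube_def
    using frac_ge_0 less_imp_le[OF frac_lt_1] by auto
qed

text \<open>
  Outside the branch domains a coordinate vanishes, or two coordinates agree, or the largest one is the
  reciprocal of an integer: countably many hyperplanes.
\<close>

lemma negligible_complement_branches:
  "negligible (unit_cube - (\<Union>j\<in>brun_branches. brun_dom j :: (real^'n::{finite,linorder}) set))"
proof (rule negligible_subset)
  let ?Z = "(\<Union>l::'n::{finite,linorder}. {x :: real^'n::{finite,linorder}. x $ l = 0})"
  let ?E = "(\<Union>(l, l')\<in>{(l, l'). l \<noteq> l'}. {x :: real^'n::{finite,linorder}. x $ l = x $ l'})"
  let ?F = "(\<Union>(l, k)\<in>(UNIV :: ('n::{finite,linorder} \<times> nat) set). {x :: real^'n::{finite,linorder}. x $ l = 1 / real k})"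
  have neg: "negligible {x :: real^'n::{finite,linorder}. x $ l = c}" for l c
    by (simp add: cart_eq_inner_axis negligible_standard_hyperplane)
  have "negligible {x :: real^'n::{finite,linorder}. x $ l = x $ l'}" if "l \<noteq> l'" for l l'
  proof -
    have "axis l 1 - axis l' 1 \<noteq> (0 :: real^'n::{finite,linorder})"
      using that by (auto simp: axis_def vec_eq_iff)
    then have "negligible {x :: real^'n::{finite,linorder}. (axis l 1 - axis l' 1) \<bullet> x = 0}" by (intro negligible_hyperplane) simp
    then show ?thesis by (simp add: inner_diff_left inner_axis' )
  qed
  then show "negligible (?Z \<union> ?E \<union> ?F)"
    using neg by (intro negligible_Un negligible_countable_Union) auto
  show "unit_cube - (\<Union>j\<in>brun_branches. brun_dom j) \<subseteq> ?Z \<union> ?E \<union> ?F"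
  proof (rule subsetI, rule ccontr)
    fix x :: "real^'n::{finite,linorder}" assume x: "x \<in> unit_cube - (\<Union>j\<in>brun_branches. brun_dom j)" and n: "x \<notin> ?Z \<union> ?E \<union> ?F"
    let ?i = "max_index x"
    define k where "k = nat \<lfloor>1 / x $ ?i\<rfloor>"
    have pos: "0 < x $ l" "x $ l \<le> 1" for l using x n by (auto simp: unit_cube_def less_le)
    have lt: "l \<noteq> ?i \<Longrightarrow> x $ l < x $ ?i" for l using n max_index_max[of x l] by (auto simp: less_le)
    have "1 \<le> 1 / x $ ?i" using pos[of ?i] by simp
    then have k: "1 \<le> k" "real k \<le> 1 / x $ ?i" "1 / x $ ?i < real k + 1"
      unfolding k_def by linarith+
    have "x $ ?i \<noteq> 1 / real k" using n by auto
    then have "x $ ?i < 1 / real k" "1 / (real k + 1) < x $ ?i"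
      using k pos[of ?i] by (auto simp: field_simps order.order_iff_strict)
    then have "x \<in> brun_dom (?i, k)" using pos lt by (simp add: brun_dom_iff)
    moreover have "(?i, k) \<in> brun_branches" using k by (simp add: brun_branches_def)
    ultimately show False using x by blast
  qed
qed

lemma branches_dense: "unit_cube = closure (\<Union>j\<in>brun_branches. brun_dom j :: (real^'n::{finite,linorder}) set)"
proof (rule antisym)
  let ?U = "\<Union>j\<in>brun_branches. brun_dom j :: (real^'n::{finite,linorder}) set"
  have "open_cube - closure ?U = {}"
  proof (rule ccontr)
    assume "open_cube - closure ?U \<noteq> {}"
    then have "\<not> negligible (open_cube - closure ?U)"
      by (intro open_not_negligible open_Diff open_open_cube) auto
    moreover have "open_cube - closure ?U \<subseteq> unit_cube - ?U"
      using open_cube_subset closure_subset[of ?U] by blast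
    ultimately show False using negligible_complement_branches negligible_subset by blast
  qed
  then have "closure open_cube \<subseteq> closure ?U" by (intro closure_minimal) auto
  then show "unit_cube \<subseteq> closure ?U" by (simp add: closure_open_cube)
  have "?U \<subseteq> unit_cube"
    using dom_subset_open_cube open_cube_subset by (fastforce simp: brun_branches_def)
  then show "closure ?U \<subseteq> unit_cube" by (intro closure_minimal) (auto simp: unit_cube_eq closed_cbox)
qed

lemma closure_dom_bounds:
  assumes "x \<in> closure (brun_dom j)" "1 \<le> snd j"
  shows "x \<in> unit_cube" "1 / (real (snd j) + 1) \<le> x $ fst j"
proof -
  let ?S = "unit_cube \<inter> {x. 1 / (real (snd j) + 1) \<le> x $ fst j}"
  have "closure (brun_dom j) \<subseteq> ?S"
  proof (rule closure_minimal)
    show "brun_dom j \<subseteq> ?S"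
      using dom_subset_open_cube[OF assms(2)] open_cube_subset by (auto simp: brun_dom_iff)
    show "closed ?S" unfolding unit_cube_eq
      by (intro closed_Int closed_cbox closed_Collect_le continuous_intros)
  qed
  then show "x \<in> unit_cube" "1 / (real (snd j) + 1) \<le> x $ fst j" using assms(1) by auto
qed

text \<open>
  The branch is \<open>F x *\<^sub>R A x\<close> with \<open>A\<close> affine and \<open>F x\<close> the inverse of the largest coordinate. On the closure of
  the domain \<open>F\<close> is bounded by \<open>K = k + 1\<close> and hence Lipschitz with constant \<open>K\<^sup>2\<close>, and \<open>A\<close> and its linear
  part are bounded by \<open>B\<close>; the product rule gives the constant \<open>L\<close>.
\<close>

lemma C1_Lip_extendable_brun:
  fixes j :: "'n::{finite,linorder} \<times> nat"
  assumes j: "1 \<le> snd j"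
  shows "C1_Lip_extendable (brun :: real^'n::{finite,linorder} \<Rightarrow> real^'n::{finite,linorder}) (brun_dom j)"
proof -
  let ?i = "fst j" and ?S = "closure (brun_dom j)"
  define K where "K = real (snd j) + 1"
  define B where "B = real CARD('n) * K"
  define lin :: "real^'n::{finite,linorder} \<Rightarrow> real^'n::{finite,linorder}" where
    "lin v = (\<chi> p. if p = slot ?i then - real (snd j) * v $ ?i else v $ turn ?i p)" for v
  define A where "A x = axis (slot ?i) 1 + lin x" for x
  define F where "F x = inverse (x $ ?i)" for x :: "real^'n::{finite,linorder}"
  define D where "D x v = F x *\<^sub>R lin v - (F x * v $ ?i * F x) *\<^sub>R A x" for x v
  have K: "1 \<le> K" by (simp add: K_def)
  have B: "0 \<le> B" using K by (simp add: B_def)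
  have linl: "linear lin" by (rule linearI) (auto simp: lin_def vec_eq_iff algebra_simps)
  have branch_map: "branch_map j x = F x *\<^sub>R A x" for x
    by (auto simp: branch_map_def F_def A_def lin_def axis_def vec_eq_iff divide_inverse)
  have linB: "norm (lin v) \<le> B * norm v" for v
  proof -
    have "\<bar>lin v $ p\<bar> \<le> K * norm v" for p
    proof (cases "p = slot ?i")
      case True
      have "real (snd j) * \<bar>v $ ?i\<bar> \<le> K * norm v"
        using component_le_norm_cart[of v ?i] by (intro mult_mono) (auto simp: K_def)
      then show ?thesis using True by (simp add: lin_def abs_mult)
    next
      case False
      have "1 * \<bar>v $ turn ?i p\<bar> \<le> K * norm v"
        using component_le_norm_cart[of v "turn ?i p"] K by (intro mult_mono) auto
      then show ?thesis using False by (simp add: lin_def)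
    qed
    then have "norm (lin v) \<le> real CARD('n) * (K * norm v)"
      by (intro order_trans[OF norm_le_l1_cart] sum_bounded_above) auto
    then show ?thesis by (simp add: B_def)
  qed
  have AB: "norm (A x) \<le> B" if "x \<in> ?S" for x
  proof -
    have x: "0 \<le> x $ l" "x $ l \<le> 1" for l using closure_dom_bounds(1)[OF that j] by (auto simp: unit_cube_def)
    have "\<bar>A x $ p\<bar> \<le> K" for p
    proof (cases "p = slot ?i")
      case True
      have "real (snd j) * x $ ?i \<le> real (snd j)" "0 \<le> real (snd j) * x $ ?i" using x[of ?i] by (simp_all add: mult_left_le)
      then have "\<bar>1 - real (snd j) * x $ ?i\<bar> \<le> K" unfolding K_def by linarith
      then show ?thesis using True by (simp add: A_def lin_def)
    next
      case False
      then show ?thesis using x[of "turn ?i p"] K by (simp add: A_def lin_def axis_def)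
    qed
    then have "norm (A x) \<le> real CARD('n) * K"
      by (intro order_trans[OF norm_le_l1_cart] sum_bounded_above) auto
    then show ?thesis by (simp add: B_def)
  qed
  have xpos: "0 < x $ ?i" if "x \<in> ?S" for x
    using closure_dom_bounds(2)[OF that j] by (rule less_le_trans[rotated]) (use j in auto)
  have F: "0 < F x" "F x \<le> K" if "x \<in> ?S" for x
    using xpos[OF that] closure_dom_bounds(2)[OF that j] by (auto simp: F_def K_def field_simps)
  have Fdiff: "\<bar>F x - F y\<bar> \<le> K\<^sup>2 * norm (x - y)" if "x \<in> ?S" "y \<in> ?S" for x y
  proof -
    have "F x - F y = F x * F y * (y - x) $ ?i"
      using xpos[OF that(1)] xpos[OF that(2)] by (simp add: F_def field_simps)
    then have "\<bar>F x - F y\<bar> = F x * F y * \<bar>(y - x) $ ?i\<bar>"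
      using F(1)[OF that(1)] F(1)[OF that(2)] by (simp add: abs_mult)
    also have "\<dots> \<le> K * K * norm (y - x)"
      using F[OF that(1)] F[OF that(2)] K component_le_norm_cart[of "y - x" ?i]
      by (intro mult_mono) auto
    finally show ?thesis by (simp add: power2_eq_square norm_minus_commute)
  qed
  have blin: "bounded_linear (D x)" for x
    unfolding linear_conv_bounded_linear[symmetric]
  proof (rule linearI)
    show "D x (b1 + b2) = D x b1 + D x b2" for b1 b2
      by (simp add: D_def linear_add[OF linl] algebra_simps)
    show "D x (r *\<^sub>R b) = r *\<^sub>R D x b" for r b
      by (simp add: D_def linear_scale[OF linl] algebra_simps)
  qed
  define G where "G x = Blinfun (D x)" for x
  have G: "blinfun_apply (G x) = D x" for x
    unfolding G_def by (rule bounded_linear_Blinfun_apply[OF blin])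
  have deriv: "(branch_map j has_derivative D x) (at x within ?S)" if "x \<in> ?S" for x
  proof -
    have l: "(lin has_derivative lin) (at x within ?S)" by (rule linear_imp_has_derivative[OF linl])
    have n: "((\<lambda>v. v $ ?i) has_derivative (\<lambda>v. v $ ?i)) (at x within ?S)"
      by (rule bounded_linear_imp_has_derivative) (rule bounded_linear_vec_nth)
    have "((\<lambda>v. inverse (v $ ?i) *\<^sub>R (axis (slot ?i) 1 + lin v)) has_derivative D x) (at x within ?S)"
      using has_derivative_scaleR[OF Deriv.has_derivative_inverse[OF _ n] has_derivative_add[OF has_derivative_const l]] xpos[OF that]
      unfolding D_def A_def F_def by (simp add: fun_eq_iff)
    moreover have "branch_map j = (\<lambda>v. inverse (v $ ?i) *\<^sub>R (axis (slot ?i) 1 + lin v))"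
      using branch_map by (simp add: fun_eq_iff A_def F_def)
    ultimately show ?thesis by simp
  qed
  define L where "L = 2 * K\<^sup>2 * B + 2 * K ^ 3 * B"
  have lip: "L-lipschitz_on ?S G"
  proof (rule lipschitz_onI)
    show "0 \<le> L" using K B by (simp add: L_def)
    fix x y assume x: "x \<in> ?S" and y: "y \<in> ?S"
    define d where "d = norm (x - y)"
    have "norm (G x - G y) \<le> L * d"
    proof (rule norm_blinfun_bound)
      show "0 \<le> L * d" using K B by (simp add: L_def d_def)
      fix v
      have "F x + F y \<le> 2 * K" "0 \<le> F x + F y" using F[OF x] F[OF y] by auto
      moreover have "F x * F x - F y * F y = (F x - F y) * (F x + F y)" by (simp add: algebra_simps)
      ultimately have F2: "\<bar>F x * F x - F y * F y\<bar> \<le> (K\<^sup>2 * d) * (2 * K)"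
        unfolding d_def using Fdiff[OF x y] by (simp only: abs_mult) (intro mult_mono, auto)
      have linA: "A x - A y = lin (x - y)" by (simp add: A_def linear_diff[OF linl])
      have vi: "\<bar>v $ ?i\<bar> \<le> norm v" by (rule component_le_norm_cart)
      have FF: "F y * F y \<le> K\<^sup>2" unfolding power2_eq_square using F[OF y] K by (intro mult_mono) auto
      have "(G x - G y) v = (F x - F y) *\<^sub>R lin v - (v $ ?i) *\<^sub>R ((F x * F x - F y * F y) *\<^sub>R A x + (F y * F y) *\<^sub>R (A x - A y))"
        by (simp add: G D_def minus_blinfun.rep_eq algebra_simps)
      also have "norm \<dots> \<le> \<bar>F x - F y\<bar> * norm (lin v) + \<bar>v $ ?i\<bar> * (\<bar>F x * F x - F y * F y\<bar> * norm (A x)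
          + (F y * F y) * norm (lin (x - y)))"
        unfolding linA using norm_triangle_ineq[of "(F x * F x - F y * F y) *\<^sub>R A x" "(F y * F y) *\<^sub>R lin (x - y)"]
        by (intro order_trans[OF norm_triangle_ineq4] add_mono) (auto simp: intro!: mult_left_mono)
      also have "\<dots> \<le> (K\<^sup>2 * d) * (B * norm v) + norm v * ((K\<^sup>2 * d) * (2 * K) * B + K\<^sup>2 * (B * d))"
        using Fdiff[OF x y] linB[of v] linB[of "x - y"] AB[OF x] F2 FF vi B K
        by (intro add_mono mult_mono) (auto simp: d_def intro!: add_nonneg_nonneg mult_nonneg_nonneg)
      also have "\<dots> = L * d * norm v" by (simp add: L_def power2_eq_square power3_eq_cube algebra_simps)
      finally show "norm ((G x - G y) v) \<le> L * d * norm v" .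
    qed
    then show "dist (G x) (G y) \<le> L * dist x y" by (simp add: dist_norm d_def)
  qed
  show ?thesis unfolding C1_Lip_extendable_def
    using deriv lip brun_on_dom[OF _ j] by (intro exI[of _ "branch_map j"] exI[of _ G] exI[of _ L]) (auto simp: G)
qed

lemma branch_system_brun:
  "branch_system unit_cube (brun :: real^'n::{finite,linorder}
      \<Rightarrow> real^'n::{finite,linorder}) brun_branches brun_dom"
proof -
  have J: "1 \<le> snd j" if "j \<in> (brun_branches :: ('n \<times> nat) set)" for j using that by (auto simp: brun_branches_def)
  have half: "(\<chi> l. (1/2 :: real)) \<in> (open_cube :: (real^'n::{finite,linorder}) set)" by (auto simp: open_cube_def)
  have "open_partition unit_cube brun_branches (brun_dom :: 'n \<times> nat \<Rightarrow> (real^'n::{finite,linorder}) set)"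
    unfolding open_partition_def
  proof (intro conjI ballI negligible_complement_branches)
    fix j :: "'n \<times> nat" assume j: "j \<in> brun_branches"
    show "open (brun_dom j)" by (rule open_brun_dom)
    show "brun_dom j \<noteq> {}" using local_inverse_in_dom[OF half J[OF j]] by blast
    show "brun_dom j \<subseteq> unit_cube" using dom_subset_open_cube[OF J[OF j]] open_cube_subset by blast
  next
    show "disjoint_family_on (brun_dom :: 'n \<times> nat \<Rightarrow> (real^'n::{finite,linorder}) set) brun_branches"
      unfolding disjoint_family_on_def using brun_dom_disjoint J by blast
  qed
  moreover have "compact (unit_cube :: (real^'n::{finite,linorder}) set)" by (simp add: unit_cube_eq compact_cbox)
  moreover have "connected (unit_cube :: (real^'n::{finite,linorder}) set)" 
    unfolding unit_cube_eq by (intro convex_connected convex_box)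
  ultimately show ?thesis unfolding branch_system_def
    using brun_unit_cube branches_dense bij_brun_dom(1)[OF J] C1_Lip_extendable_brun[OF J] by (auto simp: countable_subset[OF subset_UNIV])
qed

section \<open>Topological transitivity\<close>

text \<open>
  Move \<open>x\<close> a little into a branch domain, approximate its image by the induction hypothesis, and pull back
  by the inverse branch, which is Lipschitz.
\<close>

lemma words_approximate:
  fixes x :: "real^'n::{finite,linorder}"
  assumes "x \<in> open_cube" "0 < e"
  shows "\<exists>js y. proper js \<and> length js = n \<and> y \<in> open_cube \<and> norm (word_inverse js y - x) < e"
  using assms
proof (induction n arbitrary: x e)
  case 0
  then show ?case by (intro exI[of _ "[]"] exI[of _ x]) auto
next
  case (Suc n)
  define C where "C = 2 * real (CARD('n) + 1) ^ 4"
  have C: "0 < C" by (simp add: C_def)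
  have "x \<in> closure (\<Union>j\<in>brun_branches. brun_dom j)"
    using branches_dense Suc.prems(1) open_cube_subset by blast
  then obtain x' j where j: "j \<in> brun_branches" "x' \<in> brun_dom j" "dist x' x < e / 2"
    using Suc.prems(2) half_gt_zero unfolding closure_approachable by blast
  have j1: "1 \<le> snd j" using j(1) by (auto simp: brun_branches_def)
  have z: "branch_map j x' \<in> open_cube" by (rule branch_map_in_cube[OF j(2) j1])
  obtain js y where js: "proper js" "length js = n" "y \<in> open_cube" "norm (word_inverse js y - branch_map j x') < e / 2 / C"
    using Suc.IH[OF z, of "e / 2 / C"] Suc.prems(2) C by auto
  have "norm (word_inverse [j] (word_inverse js y) - word_inverse [j] (branch_map j x'))
      \<le> C * norm (word_inverse js y - branch_map j x')"
    unfolding C_def using js z j1 by (intro word_inverse_bounded word_inverse_in_cube) auto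
  also have "\<dots> < e / 2" using js(4) C by (simp add: pos_less_divide_eq mult.commute)
  finally have "norm (word_inverse (j # js) y - x') < e / 2"
    using local_inverse_branch_map[OF j(2) j1] by simp
  then have "norm (word_inverse (j # js) y - x) < e"
    using j(3) by (metis dist_norm dist_commute dist_triangle_half_r)
  then show ?case using js j1 by (intro exI[of _ "j # js"] exI[of _ y]) auto
qed

text \<open>
  A long inverse branch has an image of small diameter, so the point \<open>y\<close> found by \<open>words_approximate\<close> may
  be replaced by any \<open>u\<close>.
\<close>

lemma words_dense:
  fixes x u :: "real^'n::{finite,linorder}"
  assumes "x \<in> open_cube" "0 < e" "u \<in> open_cube"
  shows "\<exists>js. proper js \<and> norm (word_inverse js u - x) < e"
proof -
  define N where "N = real CARD('n)"
  have N: "0 < N" by (simp add: N_def)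
  obtain L where L: "\<And>js y y'. proper (js :: ('n \<times> nat) list) \<Longrightarrow> L \<le> length js \<Longrightarrow> y \<in> open_cube \<Longrightarrow> y' \<in> open_cube \<Longrightarrow>
    norm (word_inverse js y - word_inverse js y') \<le> (e / 2 / N) * norm (y - y')"
    using word_inverse_eventually_contracting[of "e / 2 / N", where 'n = 'n] assms(2) N by (metis divide_pos_pos zero_less_numeral)
  obtain js y where js: "proper js" "length js = L" "y \<in> open_cube" "norm (word_inverse js y - x) < e / 2"
    using words_approximate[OF assms(1), of "e / 2" L] assms(2) by auto
  have "norm (word_inverse js u - word_inverse js y) \<le> (e / 2 / N) * norm (u - y)"
    using js assms by (intro L) auto
  also have "\<dots> \<le> (e / 2 / N) * N"
    using diff_cube_le[OF assms(3) js(3)] assms(2) N by (intro mult_left_mono) (auto simp: N_def)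
  finally have "norm (word_inverse js u - word_inverse js y) \<le> e / 2" using N by simp
  then have "norm (word_inverse js u - x) < e"
    using js(4) norm_triangle_ineq[of "word_inverse js u - word_inverse js y" "word_inverse js y - x"] by simp
  then show ?thesis using js(1) by blast
qed

lemma open_word_inverse_image:
  assumes "proper js" "open W" "W \<subseteq> open_cube"
  shows "open (word_inverse js ` W)"
proof (rule invariance_of_domain)
  show "continuous_on W (word_inverse js)"
    using has_derivative_word_inverse[OF assms(1)] assms(3)
    by (intro continuous_at_imp_continuous_on) (blast intro: has_derivative_continuous)
  show "inj_on (word_inverse js) W"
    by (rule inj_on_inverseI[of _ "brun ^^ length js"]) (use brun_iterate_word_inverse assms in blast)
qed (rule assms)

text \<open>
  For an open set \<open>U\<close> let \<open>V U\<close> be the set of points that some iterate, along admissible branches, moves to \<open>U\<close>. It is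
  open, and dense by \<open>words_dense\<close>. A point common to \<open>V U\<close> for all \<open>U\<close> in a countable basis has a dense orbit.
\<close>

lemma top_transitive_brun:
  "top_transitive unit_cube (brun :: real^'n::{finite,linorder} \<Rightarrow> real^'n::{finite,linorder})"
proof -
  obtain B :: "(real^'n::{finite,linorder}) set set" where B: "countable B" "topological_basis B"
    using ex_countable_basis by blast
  define V where "V U = (\<Union>js\<in>{js. proper js}. word_inverse js ` (open_cube \<inter> U))" for U :: "(real^'n::{finite,linorder}) set"
  define \<G> where "\<G> = V ` {U \<in> B. open_cube \<inter> U \<noteq> {}}"
  have half: "(\<chi> l. (1/2 :: real)) \<in> (open_cube :: (real^'n::{finite,linorder}) set)" by (auto simp: open_cube_def)
  have "unit_cube \<subseteq> closure (\<Inter>\<G>)"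
  proof (rule Baire)
    show "closed (unit_cube :: (real^'n::{finite,linorder}) set)" unfolding unit_cube_eq by (rule closed_cbox)
    show "countable \<G>" unfolding \<G>_def using B(1) by (intro countable_image countable_subset[OF _ B(1)]) auto
    fix T assume "T \<in> \<G>"
    then obtain U where U: "U \<in> B" "open_cube \<inter> U \<noteq> {}" "T = V U" by (auto simp: \<G>_def)
    have "open U" using B(2) U(1) by (rule topological_basis_open)
    then have "open T" unfolding U(3) V_def
      by (intro open_UN ballI open_word_inverse_image open_Int open_open_cube) auto
    moreover have "T \<subseteq> unit_cube" unfolding U(3) V_def
      using word_inverse_in_cube open_cube_subset by blast
    moreover have "open_cube \<subseteq> closure T"
    proof
      fix x :: "real^'n::{finite,linorder}" assume x: "x \<in> open_cube"
      obtain u where u: "u \<in> open_cube" "u \<in> U" using U(2) by blast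
      show "x \<in> closure T" unfolding closure_approachable
      proof (intro allI impI)
        fix e :: real assume "0 < e"
        then obtain js where "proper js" "norm (word_inverse js u - x) < e"
          using words_dense[OF x _ u(1)] by blast
        then show "\<exists>y\<in>T. dist y x < e" unfolding U(3) V_def dist_norm using u by blast
      qed
    qed
    then have "unit_cube \<subseteq> closure T" unfolding closure_open_cube[symmetric] by (intro closure_minimal) auto
    ultimately show "openin (top_of_set unit_cube) T \<and> unit_cube \<subseteq> closure T"
      by (auto intro: open_subset)
  qed
  moreover have "\<Inter>\<G> \<subseteq> unit_cube"
  proof -
    obtain U where U: "U \<in> B" "(\<chi> l. (1/2 :: real)) \<in> U"
      using topological_basisE[OF B(2) open_open_cube half] by blast
    then have "V U \<in> \<G>" unfolding \<G>_def using half by blast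
    moreover have "V U \<subseteq> unit_cube" unfolding V_def using word_inverse_in_cube open_cube_subset by blast
    ultimately show ?thesis by blast
  qed
  ultimately obtain x where x: "x \<in> \<Inter>\<G>" "x \<in> unit_cube"
    using half open_cube_subset by (metis all_not_in_conv closure_empty subsetD)
  let ?O = "range (\<lambda>n. (brun ^^ n) x)"
  have "(brun ^^ n) x \<in> unit_cube" for n using x(2) by (induction n) (auto intro: brun_unit_cube)
  then have "closure ?O \<subseteq> unit_cube" by (intro closure_minimal) (auto simp: unit_cube_eq closed_cbox)
  moreover have "open_cube \<subseteq> closure ?O"
  proof
    fix y :: "real^'n::{finite,linorder}" assume y: "y \<in> open_cube"
    show "y \<in> closure ?O" unfolding closure_approachable
    proof (intro allI impI)
      fix e :: real assume "0 < e"
      then obtain U where U: "U \<in> B" "y \<in> U" "U \<subseteq> ball y e"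
        using topological_basisE[OF B(2) open_ball, of y y e] by auto
      then have "x \<in> V U" using x(1) y unfolding \<G>_def by blast
      then obtain js u where u: "proper js" "u \<in> open_cube" "u \<in> U" "x = word_inverse js u" by (auto simp: V_def)
      then have "(brun ^^ length js) x = u" using brun_iterate_word_inverse by blast
      then show "\<exists>z\<in>?O. dist z y < e" using U(3) u(3) by (auto simp: dist_commute subset_iff intro!: exI[of _ "length js"])
    qed
  qed
  then have "unit_cube \<subseteq> closure ?O" unfolding closure_open_cube[symmetric] by (intro closure_minimal) auto
  ultimately show ?thesis unfolding top_transitive_def using x(2) by blast
qed

section \<open>Non-arithmeticity\<close>

text \<open>
  If the first coordinate is the largest, the inverse branch is \<open>y \<mapsto> (1, y\<^sub>1, \<dots>, y\<^sub>m\<^sub>-\<^sub>1) / (k + y\<^sub>m)\<close>, and its fixed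
  point is \<open>(t, t\<^sup>2, \<dots>, t\<^sup>m)\<close> with \<open>t * (k + t ^ m) = 1\<close>.
\<close>

lemma fixed_point_first_branch:
  fixes k :: nat
  assumes k: "1 \<le> k"
  obtains t :: real and x :: "real^'n::{finite,linorder}" where
    "1 / (real k + 1) < t" "t < 1 / real k" "x \<in> open_cube"
    "local_inverse (idx 1, k) x = x" "denom (idx 1, k) x = 1 / t"
proof -
  let ?N = "CARD('n)"
  define i :: 'n where "i = idx 1"
  have N: "1 \<le> ?N" by (simp add: Suc_le_eq)
  have "\<exists>t::real. 0 \<le> t \<and> t \<le> 1 \<and> real k * t + t ^ (?N + 1) = 1"
    using k by (intro IVT') (auto intro!: continuous_intros)
  then obtain t :: real where t: "0 \<le> t" "t \<le> 1" "real k * t + t ^ (?N + 1) = 1" by blast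
  have t0: "t \<noteq> 0" using t(3) by auto
  have t1: "t \<noteq> 1" using t(3) k by auto
  have tt: "0 < t" "t < 1" using t t0 t1 by auto
  have D: "real k + t ^ ?N = 1 / t" using t(3) tt by (simp add: field_simps)
  have "0 < t ^ ?N" "t ^ ?N < 1" using tt N by (auto intro: power_less_one_iff[THEN iffD2])
  then have "real k < 1 / t" "1 / t < real k + 1" using D by auto
  then have b: "1 / (real k + 1) < t" "t < 1 / real k" using tt k by (auto simp: field_simps)
  define x :: "real^'n::{finite,linorder}" where "x = (\<chi> l. t ^ pos l)"
  have posi: "pos i = 1" unfolding i_def using N by (intro pos_idx) auto
  have poss: "pos (slot i) = ?N" using slot_iff[of "slot i" i] posi by simp
  have "0 < t ^ pos l \<and> t ^ pos l < 1" for l :: 'n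
    using tt pos_range[of l] by (auto simp: power_less_one_iff)
  then have xc: "x \<in> open_cube" by (simp add: open_cube_def x_def)
  have den: "denom (i, k) x = 1 / t" using D by (simp add: x_def poss)
  have "local_inverse (i, k) x $ l = x $ l" for l
  proof (cases "l = i")
    case True
    then show ?thesis unfolding local_inverse_def using den by (simp add: x_def posi)
  next
    case False
    define p where "p = unturn i l"
    have l: "l = turn i p" by (simp add: p_def)
    have "p \<noteq> slot i" using False by (simp add: p_def unturn_eq_iff)
    then have "pos l = pos p + 1"
      using slot_iff[of p i] pos_range[of p] unfolding l pos_turn posi by auto
    then show ?thesis unfolding local_inverse_def using den False by (simp add: x_def p_def)
  qed
  then have "local_inverse (i, k) x = x" by (simp add: vec_eq_iff)
  then show ?thesis using that b xc den unfolding i_def by blast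
qed

lemma non_arithmetic_brun:
  "non_arithmetic unit_cube (brun :: real^'n::{finite,linorder}
      \<Rightarrow> real^'n::{finite,linorder}) brun_branches brun_dom"
  unfolding non_arithmetic_def
proof
  assume "\<exists>c::real. {- ln \<bar>jacobian (inv_branch brun brun_dom js) x\<bar> | js (x :: real^'n::{finite,linorder}).
             js \<in> admissible_words unit_cube brun brun_branches brun_dom \<and> x \<in> unit_cube
            \<and> x \<in> branch_dom unit_cube brun brun_dom js \<and>
             inv_branch brun brun_dom js x = x} \<subseteq> range (\<lambda>z::int. c * of_int z)"
  then obtain c :: real where c: "\<And>js x :: real^'n::{finite,linorder}. js \<in> admissible_words unit_cube brun brun_branches brun_dom \<Longrightarrow> x \<in> unit_cube \<Longrightarrow>
      x \<in> branch_dom unit_cube brun brun_dom js \<Longrightarrow> inv_branch brun brun_dom js x = x \<Longrightarrow>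
      - ln \<bar>jacobian (inv_branch brun brun_dom js) x\<bar> \<in> range (\<lambda>z::int. c * of_int z)"
    by blast
  define N where "N = CARD('n) + 1"
  have ex: "\<exists>t (z::int). 1 / (real k + 1) < t \<and> t < 1 / real k
      \<and> - (real N * ln t) = c * of_int z" if k: "1 \<le> k" for k
  proof -
    obtain t :: real and x :: "real^'n::{finite,linorder}" where t: "1 / (real k + 1) < t" "t < 1 / real k" and x: "x \<in> open_cube"
      "local_inverse (idx 1, k) x = x" "denom (idx 1, k) x = 1 / t"
      using fixed_point_first_branch[OF k] by blast
    let ?js = "[(idx 1 :: 'n, k)]"
    have p: "proper ?js" using k by simp
    have t0: "0 < t" using t(1) by (rule less_trans[rotated]) simp
    obtain \<sigma> :: real where \<sigma>: "\<bar>\<sigma>\<bar> = 1" "jacobian (inv_branch brun brun_dom ?js) x = \<sigma> / word_denom ?js x ^ N"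
      using jacobian_inv_branch[OF p] x(1) unfolding N_def by blast
    have "word_denom ?js x = 1 / t" using x(3) by simp
    then have "\<bar>jacobian (inv_branch brun brun_dom ?js) x\<bar> = t ^ N"
      unfolding \<sigma>(2) using \<sigma>(1) t0 by (simp add: abs_mult power_divide)
    moreover have "- ln \<bar>jacobian (inv_branch brun brun_dom ?js) x\<bar> \<in> range (\<lambda>z::int. c * of_int z)"
    proof (rule c)
      show "?js \<in> admissible_words unit_cube brun brun_branches brun_dom" using p by (simp add: admissible_words_eq)
      show "x \<in> unit_cube" using x(1) open_cube_subset by blast
      show "x \<in> branch_dom unit_cube brun brun_dom ?js" using branch_dom_eq[OF _ p] x(1) by simp
      show "inv_branch brun brun_dom ?js x = x" using inv_branch_eq[OF x(1) p] x(2) by simp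
    qed
    ultimately show ?thesis using t t0 by (auto simp: ln_realpow)
  qed
  \<comment> \<open>For this \<open>k\<close> the gap between the values for \<open>k\<close> and \<open>k + 1\<close>, at most \<open>2 * N / k\<close>, is smaller than \<open>\<bar>c\<bar>\<close>.\<close>
  define k where "k = nat \<lceil>2 * real N / \<bar>c\<bar>\<rceil> + 1"
  have k: "1 \<le> k" "2 * real N / \<bar>c\<bar> < real k" unfolding k_def by linarith+
  obtain s y where s: "1 / (real k + 1) < s" "s < 1 / real k" "- (real N * ln s) = c * of_int y"
    using ex[OF k(1)] by blast
  obtain t z where t: "1 / (real k + 2) < t" "t < 1 / (real k + 1)" "- (real N * ln t) = c * of_int z"
    using ex[of "k + 1"] by (auto simp: add.commute)
  have pos: "0 < t" "t < s" using t s by (auto intro: less_trans[rotated])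
  then have "0 < real N * (ln s - ln t)" by (simp add: N_def)
  also have eq: "real N * (ln s - ln t) = c * of_int (z - y)" using s(3) t(3) by (simp add: algebra_simps)
  finally have nz: "c \<noteq> 0" "z \<noteq> y" "0 < c * of_int (z - y)" by auto
  have "\<bar>c\<bar> * 1 \<le> \<bar>c\<bar> * \<bar>of_int (z - y)\<bar>" using nz(2) by (intro mult_left_mono) linarith+
  then have low: "\<bar>c\<bar> \<le> real N * (ln s - ln t)" using nz(3) eq by (simp add: abs_mult[symmetric])
  have "ln s - ln t = ln (s / t)" using pos by (simp add: ln_div)
  also have "\<dots> \<le> s / t - 1" using pos by (intro ln_le_minus_one) simp
  also have "s / t \<le> (1 / real k) / (1 / (real k + 2))"
    using s t pos k(1) by (intro frac_le) auto
  also have "(1 / real k) / (1 / (real k + 2)) - 1 = 2 / real k" using k(1) by (simp add: field_simps)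
  finally have "ln s - ln t \<le> 2 / real k" by simp
  then have "\<bar>c\<bar> \<le> real N * (2 / real k)" using low by (meson mult_left_mono of_nat_0_le_iff order_trans)
  moreover have "real N * (2 / real k) < \<bar>c\<bar>" using k nz(1) by (simp add: field_simps)
  ultimately show False by simp
qed

theorem proposition2p2:
  assumes "CARD('n::{finite,linorder}) \<ge> 2"
  shows "branch_system unit_cube (brun :: real^'n::{finite,linorder} \<Rightarrow> real^'n::{finite,linorder}) brun_branches brun_dom \<and>
         markov_assumption unit_cube (brun :: real^'n::{finite,linorder} \<Rightarrow> real^'n::{finite,linorder}) brun_branches brun_dom \<and>
         non_arithmetic unit_cube (brun :: real^'n::{finite,linorder} \<Rightarrow> real^'n::{finite,linorder}) brun_branches brun_dom"
  unfolding markov_assumption_def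
  using branch_system_brun top_transitive_brun uniformly_contracting_brun bounded_distortion_brun
    markov_partition_brun non_arithmetic_brun by blast

end
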